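(* Let $M$ be a model of $T^+$ and let $\phi(x,y)$ be an $L^+(M)$-formula with $|y|=1$. Then $\phi(x,y)$ is NSOP.
   Context: For a set $M$, $[M]^2$ is the set of 2-element subsets of $M$. A labeled switchboard is $(M,<,\uparrow,\downarrow)$ where $<$ is a strict partial order on $[M]^2$ with $\{x,y\},\{x,z\}$ incomparable for distinct $x,y,z$; $\uparrow,\downarrow$ are binary relations between $M$ and $[M]^2$ such that for every $a\in M$, $\{b,c\}\in[M]^2$ exactly one of $a\uparrow\{b,c\}$, $a\in\{b,c\}$, $a\downarrow\{b,c\}$ holds; $a\uparrow\{b,c\}<\{b',c'\}$ implies $a\uparrow\{b',c'\}$; and $a\downarrow\{b,c\}>\{b',c'\}$ implies $a\downarrow\{b',c'\}$. These are structures in the relational language $L^+$ (a 4-ary symbol for $<$ on pairs, 3-ary symbols for $\uparrow,\downarrow$). The class of finite labeled switchboards is a Fraïssé class; $T^+$ is the complete theory of its Fraïssé limit. A partitioned formula $\phi(x;y)$ has the strict order property (SOP) if in some model $N$ there are $b_0,b_1,\ldots\in N^{y}$ with $\phi(N,b_0)\subsetneq\phi(N,b_1)\subsetneq\cdots$; NSOP means it does not. $x,y$ are tuples of variables and $|y|$ is the length of $y$. *)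

theory Defs
  imports Main "HOL-Library.Ramsey" "HOL-Library.Countable_Set"
begin

section \<open>Labeled switchboards\<close>

text \<open>\<^term>\<open>[M]\<^bsup>2\<^esup>\<close> is the set of 2-element subsets of \<^term>\<open>M\<close>. The three relations are
  \<^term>\<open>L\<close> (the order on pairs), \<^term>\<open>U\<close> (up-arrow) and \<^term>\<open>D\<close> (down-arrow).\<close>

definition labeled_switchboard ::
  "'a set \<Rightarrow> ('a set \<times> 'a set) set \<Rightarrow> ('a \<times> 'a set) set \<Rightarrow> ('a \<times> 'a set) set \<Rightarrow> bool" where
  "labeled_switchboard M L U D \<longleftrightarrow>
     L \<subseteq> [M]\<^bsup>2\<^esup> \<times> [M]\<^bsup>2\<^esup> \<and> irrefl L \<and> trans L \<and>
     (\<forall>x\<in>M. \<forall>y\<in>M. \<forall>z\<in>M. distinct [x, y, z] \<longrightarrow>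
        ({x, y}, {x, z}) \<notin> L \<and> ({x, z}, {x, y}) \<notin> L) \<and>
     U \<subseteq> M \<times> [M]\<^bsup>2\<^esup> \<and> D \<subseteq> M \<times> [M]\<^bsup>2\<^esup> \<and>
     (\<forall>a\<in>M. \<forall>p\<in>[M]\<^bsup>2\<^esup>.
        (a, p) \<in> U \<and> a \<notin> p \<and> (a, p) \<notin> D \<or>
        (a, p) \<notin> U \<and> a \<in> p \<and> (a, p) \<notin> D \<or>
        (a, p) \<notin> U \<and> a \<notin> p \<and> (a, p) \<in> D) \<and>
     (\<forall>a\<in>M. \<forall>p\<in>[M]\<^bsup>2\<^esup>. \<forall>q\<in>[M]\<^bsup>2\<^esup>. (a, p) \<in> U \<and> (p, q) \<in> L \<longrightarrow> (a, q) \<in> U) \<and>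
     (\<forall>a\<in>M. \<forall>p\<in>[M]\<^bsup>2\<^esup>. \<forall>q\<in>[M]\<^bsup>2\<^esup>. (a, p) \<in> D \<and> (q, p) \<in> L \<longrightarrow> (a, q) \<in> D)"


section \<open>Structures in the language \<open>L\<^sup>+\<close>\<close>

text \<open>Only the values of the relations on elements of the universe matter. Universes may be
  empty, as is usual for the finite structures of a Fraisse class.\<close>

record 'a lstruct =
  univ :: "'a set"
  lt :: "'a \<Rightarrow> 'a \<Rightarrow> 'a \<Rightarrow> 'a \<Rightarrow> bool"
  up :: "'a \<Rightarrow> 'a \<Rightarrow> 'a \<Rightarrow> bool"
  dn :: "'a \<Rightarrow> 'a \<Rightarrow> 'a \<Rightarrow> bool"

text \<open>The 4-ary relation is \<open>{a,b} < {c,d}\<close>, the 3-ary ones relate \<open>a\<close> to \<open>{b,c}\<close>. All of them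
  fail if one of the pairs degenerates, since \<^term>\<open>{a, a} \<notin> [M]\<^bsup>2\<^esup>\<close>.\<close>

definition is_labeled_switchboard :: "'a lstruct \<Rightarrow> bool" where
  "is_labeled_switchboard S \<longleftrightarrow>
     (\<exists>L U D. labeled_switchboard (univ S) L U D \<and>
       (\<forall>a\<in>univ S. \<forall>b\<in>univ S. \<forall>c\<in>univ S. \<forall>d\<in>univ S. lt S a b c d \<longleftrightarrow> ({a, b}, {c, d}) \<in> L) \<and>
       (\<forall>a\<in>univ S. \<forall>b\<in>univ S. \<forall>c\<in>univ S. up S a b c \<longleftrightarrow> (a, {b, c}) \<in> U) \<and>
       (\<forall>a\<in>univ S. \<forall>b\<in>univ S. \<forall>c\<in>univ S. dn S a b c \<longleftrightarrow> (a, {b, c}) \<in> D))"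

definition embedding :: "('a \<Rightarrow> 'b) \<Rightarrow> 'a lstruct \<Rightarrow> 'b lstruct \<Rightarrow> bool" where
  "embedding f A B \<longleftrightarrow>
     inj_on f (univ A) \<and> f ` univ A \<subseteq> univ B \<and>
     (\<forall>a\<in>univ A. \<forall>b\<in>univ A. \<forall>c\<in>univ A. \<forall>d\<in>univ A.
        lt A a b c d \<longleftrightarrow> lt B (f a) (f b) (f c) (f d)) \<and>
     (\<forall>a\<in>univ A. \<forall>b\<in>univ A. \<forall>c\<in>univ A. up A a b c \<longleftrightarrow> up B (f a) (f b) (f c)) \<and>
     (\<forall>a\<in>univ A. \<forall>b\<in>univ A. \<forall>c\<in>univ A. dn A a b c \<longleftrightarrow> dn B (f a) (f b) (f c))"

definition isomorphism :: "('a \<Rightarrow> 'b) \<Rightarrow> 'a lstruct \<Rightarrow> 'b lstruct \<Rightarrow> bool" where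
  "isomorphism f A B \<longleftrightarrow> embedding f A B \<and> f ` univ A = univ B"

definition substructure :: "'a lstruct \<Rightarrow> 'a set \<Rightarrow> 'a lstruct" where
  "substructure S A = S\<lparr>univ := A\<rparr>"


section \<open>Fraisse limits\<close>

text \<open>The language is relational, so finitely generated means finite. Every finite structure is
  isomorphic to one with universe in \<^typ>\<open>nat\<close>, so classes of finite structures are represented
  by their members with universe in \<^typ>\<open>nat\<close>.\<close>

definition age :: "'a lstruct \<Rightarrow> nat lstruct set" where
  "age S = {A. finite (univ A) \<and> (\<exists>f. embedding f A S)}"

definition ultrahomogeneous :: "'a lstruct \<Rightarrow> bool" where
  "ultrahomogeneous S \<longleftrightarrow>
     (\<forall>A B f. finite A \<and> A \<subseteq> univ S \<and> finite B \<and> B \<subseteq> univ S \<and>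
        isomorphism f (substructure S A) (substructure S B) \<longrightarrow>
        (\<exists>g. isomorphism g S S \<and> (\<forall>a\<in>A. g a = f a)))"

definition fraisse_limit :: "nat lstruct set \<Rightarrow> 'a lstruct \<Rightarrow> bool" where
  "fraisse_limit K S \<longleftrightarrow> countable (univ S) \<and> ultrahomogeneous S \<and> age S = K"

definition finite_labeled_switchboards :: "nat lstruct set" where
  "finite_labeled_switchboards = {A. finite (univ A) \<and> is_labeled_switchboard A}"


section \<open>Formulas with constants and their semantics\<close>

text \<open>An \<open>L\<^sup>+(C)\<close>-formula is a formula whose constants (given by the generated set function
  \<open>params\<close>) lie in \<open>C\<close>. In particular, an \<open>L\<^sup>+\<close>-formula is one with \<open>params \<phi> = {}\<close>.\<close>

datatype (tparams: 'c) trm = Var nat | Cst 'c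

datatype (params: 'c) fm =
    Equal "'c trm" "'c trm"
  | Less "'c trm" "'c trm" "'c trm" "'c trm"
  | Up "'c trm" "'c trm" "'c trm"
  | Down "'c trm" "'c trm" "'c trm"
  | Neg "'c fm"
  | Conj "'c fm" "'c fm"
  | Exists nat "'c fm"

fun tvars :: "'c trm \<Rightarrow> nat set" where
  "tvars (Var n) = {n}"
| "tvars (Cst c) = {}"

fun fvars :: "'c fm \<Rightarrow> nat set" where
  "fvars (Equal s t) = tvars s \<union> tvars t"
| "fvars (Less s t u v) = tvars s \<union> tvars t \<union> tvars u \<union> tvars v"
| "fvars (Up s t u) = tvars s \<union> tvars t \<union> tvars u"
| "fvars (Down s t u) = tvars s \<union> tvars t \<union> tvars u"
| "fvars (Neg \<phi>) = fvars \<phi>"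
| "fvars (Conj \<phi> \<psi>) = fvars \<phi> \<union> fvars \<psi>"
| "fvars (Exists n \<phi>) = fvars \<phi> - {n}"

text \<open>Below, \<open>h\<close> interprets the constants and \<open>e\<close> the variables.\<close>

fun tval :: "('c \<Rightarrow> 'a) \<Rightarrow> (nat \<Rightarrow> 'a) \<Rightarrow> 'c trm \<Rightarrow> 'a" where
  "tval h e (Var n) = e n"
| "tval h e (Cst c) = h c"

fun sat :: "'a lstruct \<Rightarrow> ('c \<Rightarrow> 'a) \<Rightarrow> (nat \<Rightarrow> 'a) \<Rightarrow> 'c fm \<Rightarrow> bool" where
  "sat S h e (Equal s t) \<longleftrightarrow> tval h e s = tval h e t"
| "sat S h e (Less s t u v) \<longleftrightarrow> lt S (tval h e s) (tval h e t) (tval h e u) (tval h e v)"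
| "sat S h e (Up s t u) \<longleftrightarrow> up S (tval h e s) (tval h e t) (tval h e u)"
| "sat S h e (Down s t u) \<longleftrightarrow> dn S (tval h e s) (tval h e t) (tval h e u)"
| "sat S h e (Neg \<phi>) \<longleftrightarrow> \<not> sat S h e \<phi>"
| "sat S h e (Conj \<phi> \<psi>) \<longleftrightarrow> sat S h e \<phi> \<and> sat S h e \<psi>"
| "sat S h e (Exists n \<phi>) \<longleftrightarrow> (\<exists>a\<in>univ S. sat S h (e(n := a)) \<phi>)"

definition sentences :: "'c set \<Rightarrow> 'c fm set" where
  "sentences C = {\<sigma>. fvars \<sigma> = {} \<and> params \<sigma> \<subseteq> C}"

text \<open>For sentences the choice of \<open>e\<close> is irrelevant, for sentences without constants also that
  of \<open>h\<close>.\<close>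

definition complete_theory :: "'a lstruct \<Rightarrow> 'c fm set" where
  "complete_theory S = {\<sigma> \<in> sentences {}. \<forall>h e. sat S h e \<sigma>}"

definition elementary_diagram :: "'a lstruct \<Rightarrow> 'a fm set" where
  "elementary_diagram M = {\<sigma> \<in> sentences (univ M). \<forall>e. sat M id e \<sigma>}"

definition models :: "'a lstruct \<Rightarrow> ('c \<Rightarrow> 'a) \<Rightarrow> 'c fm set \<Rightarrow> bool" where
  "models S h T \<longleftrightarrow> (\<forall>\<sigma>\<in>T. \<forall>e. sat S h e \<sigma>)"


section \<open>The strict order property\<close>

definition partitioned_formula :: "'c set \<Rightarrow> 'c fm \<Rightarrow> nat list \<Rightarrow> nat list \<Rightarrow> bool" where
  "partitioned_formula C \<phi> xs ys \<longleftrightarrow>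
     params \<phi> \<subseteq> C \<and> distinct (xs @ ys) \<and> fvars \<phi> \<subseteq> set (xs @ ys)"

definition tuples :: "'a lstruct \<Rightarrow> nat \<Rightarrow> 'a list set" where
  "tuples S n = {a. length a = n \<and> set a \<subseteq> univ S}"

text \<open>The solution set \<open>\<phi>(N, b)\<close>. Only the values of the assignment at \<open>xs @ ys\<close> matter.\<close>

definition solutions ::
  "'a lstruct \<Rightarrow> ('c \<Rightarrow> 'a) \<Rightarrow> 'c fm \<Rightarrow> nat list \<Rightarrow> nat list \<Rightarrow> 'a list \<Rightarrow> 'a list set" where
  "solutions N h \<phi> xs ys b =
     {a \<in> tuples N (length xs). sat N h (the \<circ> map_of (zip (xs @ ys) (a @ b))) \<phi>}"

text \<open>The strict order property of a partitioned \<open>L\<^sup>+(C)\<close>-formula with respect to an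
  \<open>L\<^sup>+(C)\<close>-theory \<open>T\<close>. Quantification over types is not available inside a formula, so the type
  in which the universe of the model \<open>N\<close> lives is a parameter; a statement about all models has
  that type as a free type variable.\<close>

definition SOP ::
  "'n itself \<Rightarrow> 'c set \<Rightarrow> 'c fm set \<Rightarrow> 'c fm \<Rightarrow> nat list \<Rightarrow> nat list \<Rightarrow> bool" where
  "SOP _ C T \<phi> xs ys \<longleftrightarrow>
     (\<exists>(N :: 'n lstruct) h b. h ` C \<subseteq> univ N \<and> models N h T \<and>
        (\<forall>i :: nat. b i \<in> tuples N (length ys) \<and>
           solutions N h \<phi> xs ys (b i) \<subset> solutions N h \<phi> xs ys (b (Suc i))))"

abbreviation NSOP ::
  "'n itself \<Rightarrow> 'c set \<Rightarrow> 'c fm set \<Rightarrow> 'c fm \<Rightarrow> nat list \<Rightarrow> nat list \<Rightarrow> bool" where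
  "NSOP N C T \<phi> xs ys \<equiv> \<not> SOP N C T \<phi> xs ys"

end

theory Submission
  imports Defs
begin

text \<open>A strict chain of instances \<open>\<phi>(x, b\<^sub>0) \<subset> \<phi>(x, b\<^sub>1) \<subset> \<dots>\<close> with finite set of parameters \<open>C\<close> can be
  thinned out, by Ramsey's theorem, so that all pairs \<open>(b\<^sub>i, b\<^sub>j)\<close> with \<open>i < j\<close> have the same
  quantifier-free type over \<open>C\<close>. We build a finite labeled switchboard on \<open>C\<close> and a cycle
  \<open>d\<^sub>0, \<dots>, d\<^sub>n\<^sub>-\<^sub>1\<close> in which each pair of consecutive points \<open>(d\<^sub>i, d\<^sub>i\<^sub>+\<^sub>1)\<close> has this type over \<open>C\<close>:
  the only relations forced between points further apart come from chains
  \<open>{d\<^sub>i, c\<^sub>0} < {d\<^sub>i\<^sub>+\<^sub>1, c\<^sub>1} < \<dots>\<close>, which have at most \<open>card C\<close> steps, so they do not close up if the cycle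
  is long. This switchboard embeds into the model, and since finite partial isomorphisms form a
  back-and-forth system there, the sets \<open>\<phi>(x, d\<^sub>i)\<close> (with the parameters moved by the embedding)
  increase strictly around a cycle, which is absurd.\<close>

section \<open>Partial isomorphisms\<close>

text \<open>The hypothesis on \<open>y\<close> is what keeps the chains short. With two variables,
  the set of points above \<open>{y, z}\<close> grows strictly along the order on pairs, and such
  chains may run on for ever. With one variable, the cycle meets the parameters in pairs
  \<open>{d, c}\<close> only. A step from \<open>{d, c}\<close> to \<open>{d', e}\<close> must
  change the parameter, since pairs with a common point are incomparable; and a chain cannot turn
  back, since that would compare two pairs through the same \<open>d\<close>. So parameters never
  repeat along a chain, and a height on \<open>C\<close> controls the order of the amalgam. Three
  points of the sequence are kept although the cycle copies only a pair: the third makes the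
  relation between parameters transitive and settles the labels of a point between its two
  neighbours. Labels are prescribed where a copy of the pair dictates them and are otherwise filled
  in by upward closure. The model is arbitrary, perhaps uncountable and not homogeneous. What it
  inherits from the limit is the one-point extension property, which sentences can express.\<close>

definition partial_iso :: "'a lstruct \<Rightarrow> 'b lstruct \<Rightarrow> ('a \<times> 'b) set \<Rightarrow> bool" where
  "partial_iso S T Z \<longleftrightarrow>
     (\<forall>a a'. (a, a') \<in> Z \<longrightarrow> a \<in> univ S \<and> a' \<in> univ T) \<and>
     (\<forall>a a' b b'. (a, a') \<in> Z \<longrightarrow> (b, b') \<in> Z \<longrightarrow> (a = b \<longleftrightarrow> a' = b')) \<and>
     (\<forall>a a' b b' c c'. (a, a') \<in> Z \<longrightarrow> (b, b') \<in> Z \<longrightarrow> (c, c') \<in> Z \<longrightarrow>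
        (up S a b c \<longleftrightarrow> up T a' b' c') \<and> (dn S a b c \<longleftrightarrow> dn T a' b' c')) \<and>
     (\<forall>a a' b b' c c' d d'. (a, a') \<in> Z \<longrightarrow> (b, b') \<in> Z \<longrightarrow> (c, c') \<in> Z \<longrightarrow> (d, d') \<in> Z \<longrightarrow>
        (lt S a b c d \<longleftrightarrow> lt T a' b' c' d'))"

lemma partial_isoI:
  assumes "\<And>a a'. (a, a') \<in> Z \<Longrightarrow> a \<in> univ S \<and> a' \<in> univ T"
    and "\<And>a a' b b'. (a, a') \<in> Z \<Longrightarrow> (b, b') \<in> Z \<Longrightarrow> a = b \<longleftrightarrow> a' = b'"
    and "\<And>a a' b b' c c'. (a, a') \<in> Z \<Longrightarrow> (b, b') \<in> Z \<Longrightarrow> (c, c') \<in> Z \<Longrightarrow> up S a b c \<longleftrightarrow> up T a' b' c'"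
    and "\<And>a a' b b' c c'. (a, a') \<in> Z \<Longrightarrow> (b, b') \<in> Z \<Longrightarrow> (c, c') \<in> Z \<Longrightarrow> dn S a b c \<longleftrightarrow> dn T a' b' c'"
    and "\<And>a a' b b' c c' d d'. (a, a') \<in> Z \<Longrightarrow> (b, b') \<in> Z \<Longrightarrow> (c, c') \<in> Z \<Longrightarrow> (d, d') \<in> Z \<Longrightarrow>
           lt S a b c d \<longleftrightarrow> lt T a' b' c' d'"
  shows "partial_iso S T Z"
  unfolding partial_iso_def by (intro conjI allI impI; fact assms assms(1)[THEN conjunct1] assms(1)[THEN conjunct2])

lemma partial_isoD:
  assumes "partial_iso S T Z"
  shows "(a, a') \<in> Z \<Longrightarrow> a \<in> univ S" "(a, a') \<in> Z \<Longrightarrow> a' \<in> univ T"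
    and "(a, a') \<in> Z \<Longrightarrow> (b, b') \<in> Z \<Longrightarrow> a = b \<longleftrightarrow> a' = b'"
    and "(a, a') \<in> Z \<Longrightarrow> (b, b') \<in> Z \<Longrightarrow> (c, c') \<in> Z \<Longrightarrow> up S a b c \<longleftrightarrow> up T a' b' c'"
    and "(a, a') \<in> Z \<Longrightarrow> (b, b') \<in> Z \<Longrightarrow> (c, c') \<in> Z \<Longrightarrow> dn S a b c \<longleftrightarrow> dn T a' b' c'"
    and "(a, a') \<in> Z \<Longrightarrow> (b, b') \<in> Z \<Longrightarrow> (c, c') \<in> Z \<Longrightarrow> (d, d') \<in> Z \<Longrightarrow>
           lt S a b c d \<longleftrightarrow> lt T a' b' c' d'"
proof -
  note A = assms[unfolded partial_iso_def]
  note A1 = A[THEN conjunct1, rule_format] and A2 = A[THEN conjunct2, THEN conjunct1, rule_format]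
    and A3 = A[THEN conjunct2, THEN conjunct2, THEN conjunct1, rule_format]
    and A4 = A[THEN conjunct2, THEN conjunct2, THEN conjunct2, rule_format]
  show "(a, a') \<in> Z \<Longrightarrow> a \<in> univ S" "(a, a') \<in> Z \<Longrightarrow> a' \<in> univ T"
    using A1[of a a'] by simp_all
  show "(a, a') \<in> Z \<Longrightarrow> (b, b') \<in> Z \<Longrightarrow> a = b \<longleftrightarrow> a' = b'"
    by (rule A2)
  show "(a, a') \<in> Z \<Longrightarrow> (b, b') \<in> Z \<Longrightarrow> (c, c') \<in> Z \<Longrightarrow> up S a b c \<longleftrightarrow> up T a' b' c'"
    by (rule A3[THEN conjunct1])
  show "(a, a') \<in> Z \<Longrightarrow> (b, b') \<in> Z \<Longrightarrow> (c, c') \<in> Z \<Longrightarrow> dn S a b c \<longleftrightarrow> dn T a' b' c'"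
    by (rule A3[THEN conjunct2])
  show "(a, a') \<in> Z \<Longrightarrow> (b, b') \<in> Z \<Longrightarrow> (c, c') \<in> Z \<Longrightarrow> (d, d') \<in> Z \<Longrightarrow>
           lt S a b c d \<longleftrightarrow> lt T a' b' c' d'"
    by (rule A4)
qed

lemma partial_iso_subset:
  assumes "partial_iso S T Z" "Y \<subseteq> Z"
  shows "partial_iso S T Y"
proof (rule partial_isoI)
  note D = partial_isoD[OF assms(1)] and Y = subsetD[OF assms(2)]
  show "a \<in> univ S \<and> a' \<in> univ T" if "(a, a') \<in> Y" for a a'
    using D(1,2)[OF Y[OF that]] by simp
qed (rule partial_isoD[OF assms(1)]; erule subsetD[OF assms(2)])+

lemma partial_iso_converse:
  assumes "partial_iso S T Z"
  shows "partial_iso T S (Z\<inverse>)"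
proof (rule partial_isoI)
  note D = partial_isoD[OF assms]
  show "a \<in> univ T \<and> a' \<in> univ S" if "(a, a') \<in> Z\<inverse>" for a a'
    using D(1,2)[OF converseD[OF that]] by simp
qed (rule partial_isoD(3-6)[OF assms, symmetric]; erule converseD)+

lemma partial_iso_comp:
  assumes "partial_iso S T Y" "partial_iso T R Z"
  shows "partial_iso S R (Y O Z)"
proof (rule partial_isoI)
  note D = partial_isoD[OF assms(1)] partial_isoD[OF assms(2)]
  show "a \<in> univ S \<and> a' \<in> univ R" if "(a, a') \<in> Y O Z" for a a'
    using that D(1) D(8) by blast
  show "a = b \<longleftrightarrow> a' = b'" if "(a, a') \<in> Y O Z" "(b, b') \<in> Y O Z" for a a' b b'
    using that D(3,9) by (elim relcompEpair) simp
  show "up S a b c \<longleftrightarrow> up R a' b' c'" if "(a, a') \<in> Y O Z" "(b, b') \<in> Y O Z" "(c, c') \<in> Y O Z"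
    for a a' b b' c c'
    using that D(4,10) by (elim relcompEpair) simp
  show "dn S a b c \<longleftrightarrow> dn R a' b' c'" if "(a, a') \<in> Y O Z" "(b, b') \<in> Y O Z" "(c, c') \<in> Y O Z"
    for a a' b b' c c'
    using that D(5,11) by (elim relcompEpair) simp
  show "lt S a b c d \<longleftrightarrow> lt R a' b' c' d'"
    if "(a, a') \<in> Y O Z" "(b, b') \<in> Y O Z" "(c, c') \<in> Y O Z" "(d, d') \<in> Y O Z"
    for a a' b b' c c' d d'
    using that D(6,12) by (elim relcompEpair) simp
qed

lemma partial_iso_embedding:
  assumes "embedding f S T" "A \<subseteq> univ S"
  shows "partial_iso S T ((\<lambda>a. (a, f a)) ` A)"
proof (rule partial_isoI)
  note E = assms(1)[unfolded embedding_def inj_on_def]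
  have mem: "a \<in> univ S \<and> a' = f a" if "(a, a') \<in> (\<lambda>a. (a, f a)) ` A" for a a'
    using that assms(2) by auto
  show "a \<in> univ S \<and> a' \<in> univ T" if "(a, a') \<in> (\<lambda>a. (a, f a)) ` A" for a a'
    using mem[OF that] E by auto
qed (use assms in \<open>auto simp: embedding_def inj_on_def subset_iff\<close>)

lemma embedding_partial_iso:
  assumes "partial_iso S T ((\<lambda>a. (a, f a)) ` univ S)"
  shows "embedding f S T"
proof -
  have m: "(a, f a) \<in> (\<lambda>a. (a, f a)) ` univ S" if "a \<in> univ S" for a
    using that by auto
  show ?thesis
    unfolding embedding_def inj_on_def
    using partial_isoD(3)[OF assms m m] partial_isoD(2)[OF assms m]
      partial_isoD(4,5)[OF assms m m m] partial_isoD(6)[OF assms m m m m] by auto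
qed

text \<open>A finite partial isomorphism is the graph of an isomorphism from the substructure on its
  domain to the one on its range, which is the form in which homogeneity is stated.\<close>

lemma ultrahomogeneous_extend:
  assumes "ultrahomogeneous S" "finite Z" "partial_iso S S Z"
  obtains g where "isomorphism g S S" "\<And>a b. (a, b) \<in> Z \<Longrightarrow> g a = b"
proof -
  define f where "f a = (THE b. (a, b) \<in> Z)" for a
  have f: "f a = b" if "(a, b) \<in> Z" for a b
    unfolding f_def using that partial_isoD(3)[OF assms(3)] by blast
  let ?A = "Domain Z" and ?B = "Range Z"
  have fin: "finite ?A" "finite ?B" "?A \<subseteq> univ S" "?B \<subseteq> univ S"
    using assms partial_isoD(1,2)[OF assms(3)] by (auto simp: finite_Domain finite_Range)
  have Z: "(\<lambda>a. (a, f a)) ` ?A = Z"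
    using f by (force simp: image_iff)
  have "embedding f (substructure S ?A) (substructure S ?B)"
  proof (rule embedding_partial_iso)
    show "partial_iso (substructure S ?A) (substructure S ?B)
       ((\<lambda>a. (a, f a)) ` univ (substructure S ?A))"
      using assms(3) Z unfolding partial_iso_def substructure_def by auto
  qed
  moreover have "f ` ?A = ?B" using f by (force simp: image_iff)
  ultimately have "isomorphism f (substructure S ?A) (substructure S ?B)"
    by (simp add: isomorphism_def substructure_def)
  then obtain g where "isomorphism g S S" "\<forall>a\<in>?A. g a = f a"
    using assms(1)[unfolded ultrahomogeneous_def, rule_format, of ?A ?B f] fin by auto
  then show thesis using that[of g] f by auto
qed

section \<open>Invariance of formulas under back-and-forth systems\<close>

lemma tval_cong:
  "\<forall>x\<in>tvars t. e x = e' x \<Longrightarrow> \<forall>c\<in>tparams t. h c = h' c \<Longrightarrow> tval h e t = tval h' e' t"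
  by (cases t) auto

lemma sat_cong:
  "\<forall>x\<in>fvars \<phi>. e x = e' x \<Longrightarrow> \<forall>c\<in>params \<phi>. h c = h' c \<Longrightarrow> sat S h e \<phi> \<longleftrightarrow> sat S h' e' \<phi>"
proof (induction \<phi> arbitrary: e e')
  case (Exists n \<phi>)
  have "sat S h (e(n := a)) \<phi> \<longleftrightarrow> sat S h' (e'(n := a)) \<phi>" for a
    by (rule Exists.IH) (use Exists.prems in auto)
  then show ?case by simp
next
  case (Equal s t)
  then show ?case using tval_cong[of s e e' h h'] tval_cong[of t e e' h h'] by simp
next
  case (Less s t u v)
  then show ?case using tval_cong[of s e e' h h'] tval_cong[of t e e' h h']
    tval_cong[of u e e' h h'] tval_cong[of v e e' h h'] by simp
next
  case (Up s t u)
  then show ?case using tval_cong[of s e e' h h'] tval_cong[of t e e' h h']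
    tval_cong[of u e e' h h'] by simp
next
  case (Down s t u)
  then show ?case using tval_cong[of s e e' h h'] tval_cong[of t e e' h h']
    tval_cong[of u e e' h h'] by simp
next
  case (Neg \<phi>)
  then show ?case using Neg.IH[of e e'] by simp
next
  case (Conj \<phi> \<psi>)
  have "sat S h e \<phi> \<longleftrightarrow> sat S h' e' \<phi>" "sat S h e \<psi> \<longleftrightarrow> sat S h' e' \<psi>"
    by (rule Conj.IH; use Conj.prems in simp)+
  then show ?case by simp
qed

lemma tval_rel:
  assumes "\<forall>x\<in>tvars t. (e x, e' x) \<in> Z" "\<forall>c\<in>tparams t. (h c, h' c) \<in> Z"
  shows "(tval h e t, tval h' e' t) \<in> Z"
  using assms by (cases t) auto

text \<open>Only the forth half is demanded: partial isomorphisms are relations closed under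
  converse, so the back half is the forth half for the converse of \<open>Z\<close>. This form,
  unlike ultrahomogeneity, passes to all elementarily equivalent structures.\<close>

definition back_and_forth :: "'a lstruct \<Rightarrow> bool" where
  "back_and_forth S \<longleftrightarrow> (\<forall>Z. finite Z \<and> partial_iso S S Z \<longrightarrow>
     (\<forall>a\<in>univ S. \<exists>b\<in>univ S. partial_iso S S (insert (a, b) Z)))"

lemma back_and_forthD:
  assumes "back_and_forth S" "finite Z" "partial_iso S S Z" "a \<in> univ S"
  obtains b where "b \<in> univ S" "partial_iso S S (insert (a, b) Z)"
  using assms unfolding back_and_forth_def by blast

lemma back_and_forthD':
  assumes "back_and_forth S" "finite Z" "partial_iso S S Z" "b \<in> univ S"
  obtains a where "a \<in> univ S" "partial_iso S S (insert (a, b) Z)"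
proof -
  obtain a where "a \<in> univ S" "partial_iso S S (insert (b, a) (Z\<inverse>))"
    using back_and_forthD[OF assms(1) _ partial_iso_converse[OF assms(3)] assms(4)] assms(2) by auto
  moreover have "(insert (b, a) (Z\<inverse>))\<inverse> = insert (a, b) Z" by auto
  ultimately show thesis using that partial_iso_converse by metis
qed

text \<open>The constants are matched by \<open>Z\<close> in the same way as the free variables.
  This allows the parameters of a formula to move, as they do when the amalgam is embedded away from
  the original ones.\<close>

lemma sat_partial_iso:
  assumes "back_and_forth S" "finite Z" "partial_iso S S Z"
    and "\<forall>x\<in>fvars \<phi>. (e x, e' x) \<in> Z" "\<forall>c\<in>params \<phi>. (h c, h' c) \<in> Z"
  shows "sat S h e \<phi> \<longleftrightarrow> sat S h' e' \<phi>"
  using assms(2-)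
proof (induction \<phi> arbitrary: e e' Z)
  case (Exists n \<phi>)
  note E = Exists.prems
  show ?case
  proof
    assume "sat S h e (Exists n \<phi>)"
    then obtain a where a: "a \<in> univ S" "sat S h (e(n := a)) \<phi>" by auto
    obtain b where b: "b \<in> univ S" "partial_iso S S (insert (a, b) Z)"
      using back_and_forthD[OF assms(1) E(1,2) a(1)] .
    have "sat S h (e(n := a)) \<phi> \<longleftrightarrow> sat S h' (e'(n := b)) \<phi>"
      by (rule Exists.IH[OF _ b(2)]) (use E in auto)
    then show "sat S h' e' (Exists n \<phi>)" using a b by auto
  next
    assume "sat S h' e' (Exists n \<phi>)"
    then obtain b where b: "b \<in> univ S" "sat S h' (e'(n := b)) \<phi>" by auto
    obtain a where a: "a \<in> univ S" "partial_iso S S (insert (a, b) Z)"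
      using back_and_forthD'[OF assms(1) E(1,2) b(1)] .
    have "sat S h (e(n := a)) \<phi> \<longleftrightarrow> sat S h' (e'(n := b)) \<phi>"
      by (rule Exists.IH[OF _ a(2)]) (use E in auto)
    then show "sat S h e (Exists n \<phi>)" using a b by auto
  qed
next
  case (Equal s t)
  show ?case
    using partial_isoD(3)[OF Equal(2)
      tval_rel[of s e e' Z h h']
      tval_rel[of t e e' Z h h']] Equal
    by (simp add: ball_Un)
next
  case (Less s t u v)
  show ?case
    using partial_isoD(6)[OF Less(2)
      tval_rel[of s e e' Z h h']
      tval_rel[of t e e' Z h h']
      tval_rel[of u e e' Z h h']
      tval_rel[of v e e' Z h h']] Less
    by (simp add: ball_Un)
next
  case (Up s t u)
  show ?case
    using partial_isoD(4)[OF Up(2)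
      tval_rel[of s e e' Z h h']
      tval_rel[of t e e' Z h h']
      tval_rel[of u e e' Z h h']] Up
    by (simp add: ball_Un)
next
  case (Down s t u)
  show ?case
    using partial_isoD(5)[OF Down(2)
      tval_rel[of s e e' Z h h']
      tval_rel[of t e e' Z h h']
      tval_rel[of u e e' Z h h']] Down
    by (simp add: ball_Un)
next
  case (Neg \<phi>)
  show ?case using Neg.IH[of Z e e'] Neg.prems by simp
next
  case (Conj \<phi> \<psi>)
  show ?case using Conj.IH(1)[of Z e e'] Conj.IH(2)[of Z e e'] Conj.prems by (simp add: ball_Un)
qed

section \<open>Diagrams and elementary equivalence\<close>

text \<open>The empty conjunction: a sentence without constants that holds in every structure, the
  empty one included.\<close>

definition true_fm :: "'c fm" where
  "true_fm = Neg (Exists 0 (Neg (Equal (Var 0) (Var 0))))"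

definition conjs :: "'c fm list \<Rightarrow> 'c fm" where
  "conjs \<phi>s = foldr Conj \<phi>s true_fm"

lemma sat_conjs: "sat S h e (conjs \<phi>s) \<longleftrightarrow> (\<forall>\<phi>\<in>set \<phi>s. sat S h e \<phi>)"
  by (induction \<phi>s) (auto simp: conjs_def true_fm_def)

lemma fvars_conjs: "fvars (conjs \<phi>s) = (\<Union>\<phi>\<in>set \<phi>s. fvars \<phi>)"
  by (induction \<phi>s) (auto simp: conjs_def true_fm_def)

lemma params_conjs: "params (conjs \<phi>s) = (\<Union>\<phi>\<in>set \<phi>s. params \<phi>)"
  by (induction \<phi>s) (auto simp: conjs_def true_fm_def)

lemma sat_foldr_Exists:
  "sat S h e (foldr Exists ns \<phi>) \<longleftrightarrow>
     (\<exists>e'. (\<forall>n. n \<notin> set ns \<longrightarrow> e' n = e n) \<and> (\<forall>n\<in>set ns. e' n \<in> univ S) \<and> sat S h e' \<phi>)"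
proof (induction ns arbitrary: e)
  case Nil
  show ?case by (auto simp flip: fun_eq_iff)
next
  case (Cons m ns)
  show ?case (is "_ \<longleftrightarrow> ?R")
  proof
    assume "sat S h e (foldr Exists (m # ns) \<phi>)"
    then obtain a e' where "a \<in> univ S" "\<forall>n. n \<notin> set ns \<longrightarrow> e' n = (e(m := a)) n"
      "\<forall>n\<in>set ns. e' n \<in> univ S" "sat S h e' \<phi>"
      by (auto simp: Cons.IH)
    moreover from this have "e' m \<in> univ S" by (cases "m \<in> set ns") auto
    ultimately show ?R by (intro exI[of _ e']) auto
  next
    assume ?R
    then obtain e' where "\<forall>n. n \<notin> set (m # ns) \<longrightarrow> e' n = e n" "\<forall>n\<in>set (m # ns). e' n \<in> univ S"
      "sat S h e' \<phi>" by blast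
    then have "sat S h (e(m := e' m)) (foldr Exists ns \<phi>)" "e' m \<in> univ S"
      unfolding Cons.IH by auto
    then show "sat S h e (foldr Exists (m # ns) \<phi>)" by auto
  qed
qed

lemma fvars_foldr_Exists: "fvars (foldr Exists ns \<phi>) = fvars \<phi> - set ns"
  by (induction ns) auto

lemma params_foldr_Exists: "params (foldr Exists ns \<phi>) = params \<phi>"
  by (induction ns) auto

definition literal :: "bool \<Rightarrow> 'c fm \<Rightarrow> 'c fm" where
  "literal b \<phi> = (if b then \<phi> else Neg \<phi>)"

lemma literal_simps [simp]:
  "sat S h e (literal b \<phi>) \<longleftrightarrow> (b \<longleftrightarrow> sat S h e \<phi>)"
  "fvars (literal b \<phi>) = fvars \<phi>" "params (literal b \<phi>) = params \<phi>"
  by (auto simp: literal_def)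

definition diagram :: "'a lstruct \<Rightarrow> 'a list \<Rightarrow> 'c fm" where
  "diagram S as = (let I = [0..<length as] in
     conjs (
       [literal (as ! i = as ! j) (Equal (Var i) (Var j)). i \<leftarrow> I, j \<leftarrow> I] @
       [literal (up S (as ! i) (as ! j) (as ! k)) (Up (Var i) (Var j) (Var k)). i \<leftarrow> I, j \<leftarrow> I, k \<leftarrow> I] @
       [literal (dn S (as ! i) (as ! j) (as ! k)) (Down (Var i) (Var j) (Var k)). i \<leftarrow> I, j \<leftarrow> I, k \<leftarrow> I] @
       [literal (lt S (as ! i) (as ! j) (as ! k) (as ! l)) (Less (Var i) (Var j) (Var k) (Var l)).
          i \<leftarrow> I, j \<leftarrow> I, k \<leftarrow> I, l \<leftarrow> I]))"

lemma fvars_diagram: "fvars (diagram S as) \<subseteq> {..<length as}"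
  by (auto simp: diagram_def Let_def fvars_conjs)

lemma params_diagram: "params (diagram S as) = {}"
  by (auto simp: diagram_def Let_def params_conjs)

lemma partial_iso_image_iff:
  "partial_iso S T ((\<lambda>i. (f i, g i)) ` I) \<longleftrightarrow>
     (\<forall>i\<in>I. f i \<in> univ S \<and> g i \<in> univ T) \<and>
     (\<forall>i\<in>I. \<forall>j\<in>I. f i = f j \<longleftrightarrow> g i = g j) \<and>
     (\<forall>i\<in>I. \<forall>j\<in>I. \<forall>k\<in>I. up S (f i) (f j) (f k) \<longleftrightarrow> up T (g i) (g j) (g k)) \<and>
     (\<forall>i\<in>I. \<forall>j\<in>I. \<forall>k\<in>I. dn S (f i) (f j) (f k) \<longleftrightarrow> dn T (g i) (g j) (g k)) \<and>
     (\<forall>i\<in>I. \<forall>j\<in>I. \<forall>k\<in>I. \<forall>l\<in>I.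
        lt S (f i) (f j) (f k) (f l) \<longleftrightarrow> lt T (g i) (g j) (g k) (g l))"
    (is "partial_iso S T ?Z \<longleftrightarrow> ?R")
proof
  assume Z: "partial_iso S T ?Z"
  have m: "(f i, g i) \<in> ?Z" if "i \<in> I" for i using that by auto
  show ?R
    by (intro conjI ballI partial_isoD(1)[OF Z m] partial_isoD(2)[OF Z m] partial_isoD(3)[OF Z m m]
        partial_isoD(4)[OF Z m m m] partial_isoD(5)[OF Z m m m] partial_isoD(6)[OF Z m m m m])
next
  assume ?R
  then show "partial_iso S T ?Z"
    by (intro partial_isoI) (clarsimp; fail)+
qed

lemma sat_diagram:
  assumes "set as \<subseteq> univ S" "\<And>i. i < length as \<Longrightarrow> e i \<in> univ T"
  shows "sat T h e (diagram S as) \<longleftrightarrow> partial_iso S T ((\<lambda>i. (as ! i, e i)) ` {..<length as})"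
proof -
  have "as ! i \<in> univ S" if "i < length as" for i using assms that by auto
  then show ?thesis
    unfolding diagram_def Let_def sat_conjs partial_iso_image_iff
    using assms(2) by (simp add: ball_Un atLeast0LessThan)
qed

text \<open>No constant occurs in these sentences, yet they carry a type of constants; it is an
  argument so that it can be the type over which the given theory is written.\<close>

definition elementarily_equivalent :: "'c itself \<Rightarrow> 'a lstruct \<Rightarrow> 'b lstruct \<Rightarrow> bool" where
  "elementarily_equivalent _ S T \<longleftrightarrow>
     (\<forall>\<sigma>\<in>sentences {} :: 'c fm set. \<forall>h e h' e'. sat S h e \<sigma> \<longleftrightarrow> sat T h' e' \<sigma>)"

lemma elementarily_equivalent_sym:
  "elementarily_equivalent C S T \<Longrightarrow> elementarily_equivalent C T S"
  unfolding elementarily_equivalent_def by blast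

lemma elementarily_equivalent_complete_theory:
  assumes "models T h (complete_theory S :: 'c fm set)"
  shows "elementarily_equivalent TYPE('c) S T"
  unfolding elementarily_equivalent_def
proof (intro ballI allI)
  fix \<sigma> :: "'c fm" and hS eS hT eT
  assume \<sigma>: "\<sigma> \<in> sentences {}"
  have S: "sat S hS eS \<sigma> \<longleftrightarrow> sat S hS' eS' \<sigma>" for hS' eS'
    using \<sigma> by (intro sat_cong) (auto simp: sentences_def)
  have T: "sat T hT eT \<sigma> \<longleftrightarrow> sat T hT' eT' \<sigma>" for hT' eT'
    using \<sigma> by (intro sat_cong) (auto simp: sentences_def)
  show "sat S hS eS \<sigma> \<longleftrightarrow> sat T hT eT \<sigma>"
  proof (cases "sat S hS eS \<sigma>")
    case True
    then have "\<sigma> \<in> complete_theory S" using \<sigma> S by (auto simp: complete_theory_def)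
    then show ?thesis using assms True T unfolding models_def by blast
  next
    case False
    then have "Neg \<sigma> \<in> complete_theory S" using \<sigma> S by (auto simp: complete_theory_def sentences_def)
    then have "sat T h e (Neg \<sigma>)" for e using assms unfolding models_def by blast
    then show ?thesis using False T by auto
  qed
qed

text \<open>The language is finite and relational, so one formula, the diagram, determines a finite
  tuple up to partial isomorphism; its existential closure is a sentence and transfers.\<close>

lemma partial_iso_realize:
  assumes "elementarily_equivalent TYPE('c) S T" "set as \<subseteq> univ S"
  obtains f where "partial_iso S T ((\<lambda>i. (as ! i, f i)) ` {..<length as})"
proof -
  define \<sigma> :: "'c fm" where "\<sigma> = foldr Exists [0..<length as] (diagram S as)"
  have s: "\<sigma> \<in> sentences {}"
    using fvars_diagram[of S as]
    by (auto simp: \<sigma>_def sentences_def fvars_foldr_Exists params_foldr_Exists params_diagram)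
  define e where "e i = as ! i" for i
  have "partial_iso S S ((\<lambda>i. (as ! i, e i)) ` {..<length as})"
    using assms(2) by (auto simp: partial_iso_image_iff e_def)
  then have "sat S h e \<sigma>" for h
    using nth_mem[of _ as] assms(2) sat_diagram[OF assms(2), of e S h]
    unfolding \<sigma>_def sat_foldr_Exists e_def subset_iff by (intro exI[of _ "\<lambda>i. as ! i"]) simp
  then have "sat T undefined undefined \<sigma>"
    using assms(1) s unfolding elementarily_equivalent_def by blast
  then obtain f where f: "\<forall>i\<in>set [0..<length as]. f i \<in> univ T" "sat T undefined f (diagram S as :: 'c fm)"
    unfolding \<sigma>_def sat_foldr_Exists by blast
  then have "partial_iso S T ((\<lambda>i. (as ! i, f i)) ` {..<length as})"
    using sat_diagram[OF assms(2), of f T "undefined :: 'c \<Rightarrow> 'b"] by simp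
  then show thesis by (rule that)
qed

lemma age_elementarily_equivalent_subset:
  assumes "elementarily_equivalent TYPE('c) S T"
  shows "age S \<subseteq> age T"
proof
  fix A assume "A \<in> age S"
  then obtain f where A: "finite (univ A)" and f: "embedding f A S" unfolding age_def by blast
  define ns where "ns = sorted_list_of_set (univ A)"
  have ns: "set ns = univ A" "distinct ns" using A by (auto simp: ns_def)
  have "set (map f ns) \<subseteq> univ S" using f ns by (auto simp: embedding_def)
  then obtain g where g: "partial_iso S T ((\<lambda>i. (map f ns ! i, g i)) ` {..<length (map f ns)})"
    using partial_iso_realize[OF assms] by blast
  define idx where "idx a = (THE i. i < length ns \<and> ns ! i = a)" for a
  have idx: "idx (ns ! i) = i" if "i < length ns" for i
    unfolding idx_def using that ns by (auto simp: nth_eq_iff_index_eq)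
  have "partial_iso A S ((\<lambda>a. (a, f a)) ` univ A)"
    by (rule partial_iso_embedding[OF f]) simp
  from partial_iso_comp[OF this g] have "partial_iso A T ((\<lambda>a. (a, g (idx a))) ` univ A)"
  proof (rule partial_iso_subset, intro subsetI)
    fix p assume "p \<in> (\<lambda>a. (a, g (idx a))) ` univ A"
    then obtain i where i: "i < length ns" "p = (ns ! i, g (idx (ns ! i)))"
      unfolding ns(1)[symmetric] by (auto simp: in_set_conv_nth)
    have "(ns ! i, f (ns ! i)) \<in> (\<lambda>a. (a, f a)) ` univ A" using i(1) ns(1) by auto
    moreover have "(f (ns ! i), g i) \<in> (\<lambda>i. (map f ns ! i, g i)) ` {..<length (map f ns)}"
      using i(1) by (auto simp: image_iff intro!: bexI[of _ i])
    ultimately show "p \<in> (\<lambda>a. (a, f a)) ` univ A O (\<lambda>i. (map f ns ! i, g i)) ` {..<length (map f ns)}"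
      using i idx[OF i(1)] by auto
  qed
  then have "embedding (\<lambda>a. g (idx a)) A T" by (rule embedding_partial_iso)
  then show "A \<in> age T" using A unfolding age_def by blast
qed

text \<open>For a fixed tuple \<open>as\<close> and point \<open>a\<close>, one sentence says that
  every realization of the diagram of \<open>as\<close> extends to one of \<open>as @ [a]\<close>.
  In \<open>S\<close> some realization of the large diagram exists, and an automorphism moves its
  first part onto any given realization of the small one. The sentence then transfers to
  \<open>T\<close>.\<close>

lemma back_and_forth_ultrahomogeneous:
  assumes "elementarily_equivalent TYPE('c) S T" "ultrahomogeneous S"
  shows "back_and_forth T"
  unfolding back_and_forth_def
proof (intro allI impI ballI, elim conjE)
  fix Z a assume Z: "finite Z" "partial_iso T T Z" and a: "a \<in> univ T"
  note sym = elementarily_equivalent_sym[OF assms(1)]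
  obtain zs where zs: "set zs = Z" using Z(1) finite_list by blast
  define as where "as = map fst zs"
  define bs where "bs = map snd zs"
  define n where "n = length zs"
  have len: "length as = n" "length bs = n" "length (as @ [a]) = Suc n"
    by (simp_all add: as_def bs_def n_def)
  have Zn: "(\<lambda>i. (as ! i, bs ! i)) ` {..<n} = Z"
    by (auto simp: as_def bs_def n_def set_conv_nth image_iff simp flip: zs)
  have as: "set as \<subseteq> univ T" "set bs \<subseteq> univ T"
    using partial_isoD(1,2)[OF Z(2)] by (auto simp: as_def bs_def zs)
  then have asa: "set (as @ [a]) \<subseteq> univ T" using a by simp
  \<comment> \<open>The reference realization in \<open>S\<close>, with \<open>f n\<close> playing
    the role of \<open>a\<close>; the automorphism \<open>g\<close> below carries it onto an
    arbitrary tuple \<open>v\<close>.\<close>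
  obtain f where f: "partial_iso T S ((\<lambda>i. ((as @ [a]) ! i, f i)) ` {..<Suc n})"
    using partial_iso_realize[OF sym asa] unfolding len by blast
  have f0: "partial_iso T S ((\<lambda>i. (as ! i, f i)) ` {..<n})"
    by (rule partial_iso_subset[OF f]) (auto simp: nth_append len image_iff intro!: bexI)
  define \<sigma> :: "'c fm" where "\<sigma> = Neg (foldr Exists [0..<n]
    (Conj (diagram T as) (Neg (Exists n (diagram T (as @ [a]))))))"
  have "\<sigma> \<in> sentences {}"
    using fvars_diagram[of T as] fvars_diagram[of T "as @ [a]"]
    by (auto simp: \<sigma>_def sentences_def fvars_foldr_Exists params_foldr_Exists params_diagram len)
  moreover have "sat S h e \<sigma>" for h e
  proof -
    have "sat S h v (Exists n (diagram T (as @ [a]) :: 'c fm))"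
      if v: "\<And>i. i < n \<Longrightarrow> v i \<in> univ S" and sv: "sat S h v (diagram T as :: 'c fm)" for v
    proof -
      have "partial_iso T S ((\<lambda>i. (as ! i, v i)) ` {..<n})"
        using sat_diagram[OF as(1), of v S h] v sv len by simp
      from partial_iso_comp[OF partial_iso_converse[OF f0] this]
      have "partial_iso S S ((\<lambda>i. (f i, v i)) ` {..<n})"
        by (rule partial_iso_subset) auto
      then obtain g where g: "isomorphism g S S" "\<And>i. i < n \<Longrightarrow> g (f i) = v i"
        using ultrahomogeneous_extend[OF assms(2)] by (metis (mono_tags, lifting) finite_imageI finite_lessThan image_eqI lessThan_iff)
      have "partial_iso S S ((\<lambda>a. (a, g a)) ` univ S)"
        using g(1) by (intro partial_iso_embedding) (auto simp: isomorphism_def)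
      from partial_iso_comp[OF f this]
      have *: "partial_iso T S ((\<lambda>i. ((as @ [a]) ! i, g (f i))) ` {..<Suc n})"
      proof (rule partial_iso_subset, intro subsetI)
        fix p assume "p \<in> (\<lambda>i. ((as @ [a]) ! i, g (f i))) ` {..<Suc n}"
        then obtain i where i: "i < Suc n" "p = ((as @ [a]) ! i, g (f i))" by auto
        moreover have m: "((as @ [a]) ! i, f i) \<in> (\<lambda>i. ((as @ [a]) ! i, f i)) ` {..<Suc n}"
          using i by auto
        ultimately show "p \<in> (\<lambda>i. ((as @ [a]) ! i, f i)) ` {..<Suc n} O (\<lambda>a. (a, g a)) ` univ S"
          using partial_isoD(2)[OF f m] by auto
      qed
      let ?v = "v(n := g (f n))"
      have v': "?v i = g (f i)" if "i < Suc n" for i using g(2) that by (auto simp: less_Suc_eq)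
      have "g (f i) \<in> univ S" if "i < Suc n" for i
        using partial_isoD(2)[OF *] that by (metis (mono_tags, lifting) image_eqI lessThan_iff)
      moreover have "partial_iso T S ((\<lambda>i. ((as @ [a]) ! i, ?v i)) ` {..<Suc n})"
        using * v' by (metis (mono_tags, lifting) image_cong lessThan_iff)
      ultimately have "sat S h ?v (diagram T (as @ [a]))"
        using sat_diagram[OF asa, of ?v S h] v' len by simp
      then show ?thesis using \<open>\<And>i. i < Suc n \<Longrightarrow> g (f i) \<in> univ S\<close> by auto
    qed
    then show ?thesis unfolding \<sigma>_def by (auto simp: sat_foldr_Exists simp del: sat.simps(7))
  qed
  ultimately have "sat T h e \<sigma>" for h e
    using assms(1) unfolding elementarily_equivalent_def by blast
  then obtain h :: "'c \<Rightarrow> 'b" where \<sigma>: "sat T h e \<sigma>" for e by blast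
  \<comment> \<open>The tuple \<open>bs\<close> realizes the diagram of \<open>as\<close> because
    \<open>Z\<close> is a partial isomorphism, so the transferred sentence supplies the image of
    \<open>a\<close>.\<close>
  define v where "v i = bs ! i" for i
  have v: "v i \<in> univ T" if "i < n" for i using that as len by (auto simp: v_def)
  have "sat T h v (diagram T as)"
    using sat_diagram[OF as(1), of v T h] v len Z(2) Zn unfolding v_def by simp
  then have "sat T h v (Exists n (diagram T (as @ [a])))"
    using \<sigma>[of v] v unfolding \<sigma>_def by (auto simp: sat_foldr_Exists simp del: sat.simps(7))
  then obtain b where b: "b \<in> univ T" "sat T h (v(n := b)) (diagram T (as @ [a]))"
    by auto
  then have "partial_iso T T ((\<lambda>i. ((as @ [a]) ! i, (v(n := b)) i)) ` {..<Suc n})"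
    using sat_diagram[OF asa, of "v(n := b)" T h] v len by (simp add: less_Suc_eq)
  moreover have "(\<lambda>i. ((as @ [a]) ! i, (v(n := b)) i)) ` {..<Suc n} = insert (a, b) Z"
  proof -
    have "(\<lambda>i. ((as @ [a]) ! i, (v(n := b)) i)) ` {..<n} = Z"
      unfolding Zn[symmetric] by (rule image_cong) (auto simp: nth_append len v_def)
    then show ?thesis by (simp add: lessThan_Suc nth_append len)
  qed
  ultimately show "\<exists>b\<in>univ T. partial_iso T T (insert (a, b) Z)" using b by auto
qed

section \<open>Switchboards\<close>

text \<open>Pairs are represented by their two points. \<open>L_common\<close> expresses
  irreflexivity, by the instance \<open>b = c\<close>, together with the incomparability of pairs
  sharing a point.\<close>

locale pair_order =
  fixes A :: "'a set" and L :: "'a \<Rightarrow> 'a \<Rightarrow> 'a \<Rightarrow> 'a \<Rightarrow> bool"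
  assumes L_dom: "L a b c d \<Longrightarrow> a \<in> A \<and> b \<in> A \<and> c \<in> A \<and> d \<in> A"
    and L_neq: "L a b c d \<Longrightarrow> a \<noteq> b \<and> c \<noteq> d"
    and L_swap1: "L a b c d \<longleftrightarrow> L b a c d"
    and L_swap2: "L a b c d \<longleftrightarrow> L a b d c"
    and L_common: "\<not> L a b a c"
    and L_trans: "L a b c d \<Longrightarrow> L c d e f \<Longrightarrow> L a b e f"

locale switchboard = pair_order A L
  for A :: "'a set" and L :: "'a \<Rightarrow> 'a \<Rightarrow> 'a \<Rightarrow> 'a \<Rightarrow> bool" +
  fixes U D :: "'a \<Rightarrow> 'a \<Rightarrow> 'a \<Rightarrow> bool"
  assumes U_dom: "U a b c \<Longrightarrow> a \<in> A \<and> b \<in> A \<and> c \<in> A \<and> a \<noteq> b \<and> a \<noteq> c \<and> b \<noteq> c"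
    and D_dom: "D a b c \<Longrightarrow> a \<in> A \<and> b \<in> A \<and> c \<in> A \<and> a \<noteq> b \<and> a \<noteq> c \<and> b \<noteq> c"
    and U_swap: "U a b c \<longleftrightarrow> U a c b"
    and D_swap: "D a b c \<longleftrightarrow> D a c b"
    and U_D: "U a b c \<Longrightarrow> \<not> D a b c"
    and U_or_D: "a \<in> A \<Longrightarrow> b \<in> A \<Longrightarrow> c \<in> A \<Longrightarrow> a \<noteq> b \<Longrightarrow> a \<noteq> c \<Longrightarrow> b \<noteq> c \<Longrightarrow> U a b c \<or> D a b c"
    and U_mono: "U a b c \<Longrightarrow> L b c d e \<Longrightarrow> U a d e"
    and D_mono: "D a d e \<Longrightarrow> L b c d e \<Longrightarrow> D a b c"

text \<open>The relations of a structure are arbitrary outside its universe, while the locales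
  confine them to \<open>A\<close>; \<open>on3\<close> and \<open>on4\<close> cut them down.\<close>

definition on3 :: "'a set \<Rightarrow> ('a \<Rightarrow> 'a \<Rightarrow> 'a \<Rightarrow> bool) \<Rightarrow> 'a \<Rightarrow> 'a \<Rightarrow> 'a \<Rightarrow> bool" where
  "on3 A R a b c \<longleftrightarrow> a \<in> A \<and> b \<in> A \<and> c \<in> A \<and> R a b c"

definition on4 :: "'a set \<Rightarrow> ('a \<Rightarrow> 'a \<Rightarrow> 'a \<Rightarrow> 'a \<Rightarrow> bool) \<Rightarrow> 'a \<Rightarrow> 'a \<Rightarrow> 'a \<Rightarrow> 'a \<Rightarrow> bool" where
  "on4 A R a b c d \<longleftrightarrow> a \<in> A \<and> b \<in> A \<and> c \<in> A \<and> d \<in> A \<and> R a b c d"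

abbreviation switchboard_of :: "'a lstruct \<Rightarrow> bool" where
  "switchboard_of S \<equiv> switchboard (univ S) (on4 (univ S) (lt S)) (on3 (univ S) (up S)) (on3 (univ S) (dn S))"

lemma switchboard_of_labeled:
  assumes "is_labeled_switchboard S"
  shows "switchboard_of S"
proof -
  obtain L U D where S: "labeled_switchboard (univ S) L U D"
    and lt': "\<forall>a\<in>univ S. \<forall>b\<in>univ S. \<forall>c\<in>univ S. \<forall>d\<in>univ S. lt S a b c d \<longleftrightarrow> ({a, b}, {c, d}) \<in> L"
    and up': "\<forall>a\<in>univ S. \<forall>b\<in>univ S. \<forall>c\<in>univ S. up S a b c \<longleftrightarrow> (a, {b, c}) \<in> U"
    and dn': "\<forall>a\<in>univ S. \<forall>b\<in>univ S. \<forall>c\<in>univ S. dn S a b c \<longleftrightarrow> (a, {b, c}) \<in> D"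
    using assms unfolding is_labeled_switchboard_def by blast
  note lt = lt'[rule_format] and up = up'[rule_format] and dn = dn'[rule_format]
  note S' = S[unfolded labeled_switchboard_def]
  have L: "L \<subseteq> [univ S]\<^bsup>2\<^esup> \<times> [univ S]\<^bsup>2\<^esup>" "irrefl L" "trans L"
    and U: "U \<subseteq> univ S \<times> [univ S]\<^bsup>2\<^esup>" and D: "D \<subseteq> univ S \<times> [univ S]\<^bsup>2\<^esup>"
    using S' by simp_all
  note inc = S'[THEN conjunct2, THEN conjunct2, THEN conjunct2, THEN conjunct1, rule_format, THEN conjunct1]
  note R = S'[THEN conjunct2, THEN conjunct2, THEN conjunct2, THEN conjunct2, THEN conjunct2, THEN conjunct2]
  note tri = R[THEN conjunct1, rule_format]
    and um = R[THEN conjunct2, THEN conjunct1, rule_format]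
    and dm = R[THEN conjunct2, THEN conjunct2, rule_format]
  have Um: "(a, q) \<in> U" if "(a, p) \<in> U" "(p, q) \<in> L" for a p q
    by (rule um[of a p q]) (use that L(1) U in auto)
  have Dm: "(a, q) \<in> D" if "(a, p) \<in> D" "(q, p) \<in> L" for a p q
    by (rule dm[of a p q]) (use that L(1) D in auto)
  have Ld: "a \<in> univ S \<and> b \<in> univ S \<and> c \<in> univ S \<and> d \<in> univ S \<and> a \<noteq> b \<and> c \<noteq> d"
    if "({a, b}, {c, d}) \<in> L" for a b c d
    using subsetD[OF L(1) that] by simp
  have Ud: "a \<in> univ S \<and> b \<in> univ S \<and> c \<in> univ S \<and> b \<noteq> c \<and> a \<noteq> b \<and> a \<noteq> c"
    if "(a, {b, c}) \<in> U" for a b c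
    using subsetD[OF U that] tri[of a "{b, c}"] that by auto
  have Dd: "a \<in> univ S \<and> b \<in> univ S \<and> c \<in> univ S \<and> b \<noteq> c \<and> a \<noteq> b \<and> a \<noteq> c"
    if "(a, {b, c}) \<in> D" for a b c
    using subsetD[OF D that] tri[of a "{b, c}"] that by auto
  have "on4 (univ S) (lt S) a b c d \<longleftrightarrow> ({a, b}, {c, d}) \<in> L" for a b c d
    using lt[of a b c d] Ld[of a b c d] unfolding on4_def by blast
  moreover have "on3 (univ S) (up S) a b c \<longleftrightarrow> (a, {b, c}) \<in> U" for a b c
    using up[of a b c] Ud[of a b c] unfolding on3_def by blast
  moreover have "on3 (univ S) (dn S) a b c \<longleftrightarrow> (a, {b, c}) \<in> D" for a b c
    using dn[of a b c] Dd[of a b c] unfolding on3_def by blast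
  ultimately have eqs: "on4 (univ S) (lt S) = (\<lambda>a b c d. ({a, b}, {c, d}) \<in> L)"
    "on3 (univ S) (up S) = (\<lambda>a b c. (a, {b, c}) \<in> U)"
    "on3 (univ S) (dn S) = (\<lambda>a b c. (a, {b, c}) \<in> D)"
    by presburger+
  show ?thesis
    unfolding eqs
  proof
    show "({a, b}, {a, c}) \<notin> L" for a b c
    proof
      assume H: "({a, b}, {a, c}) \<in> L"
      then have "a \<noteq> b" "a \<noteq> c" "a \<in> univ S" "b \<in> univ S" "c \<in> univ S" using Ld by blast+
      moreover have "b \<noteq> c" using H L(2) by (auto simp: irrefl_def)
      ultimately show False using inc[of a b c] H by auto
    qed
    show "(a, {b, c}) \<in> U \<or> (a, {b, c}) \<in> D"
      if "a \<in> univ S" "b \<in> univ S" "c \<in> univ S" "a \<noteq> b" "a \<noteq> c" "b \<noteq> c" for a b c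
      using tri[of a "{b, c}"] that by auto
    show "(a, {b, c}) \<notin> D" if "(a, {b, c}) \<in> U" for a b c
      using Ud[OF that] tri[of a "{b, c}"] that by auto
    show "({a, b}, {e, f}) \<in> L" if "({a, b}, {c, d}) \<in> L" "({c, d}, {e, f}) \<in> L" for a b c d e f
      using transD[OF L(3) that] .
    show "a \<in> univ S \<and> b \<in> univ S \<and> c \<in> univ S \<and> d \<in> univ S"
      if "({a, b}, {c, d}) \<in> L" for a b c d using Ld[OF that] by blast
    show "a \<noteq> b \<and> c \<noteq> d" if "({a, b}, {c, d}) \<in> L" for a b c d using Ld[OF that] by blast
    show "a \<in> univ S \<and> b \<in> univ S \<and> c \<in> univ S \<and> a \<noteq> b \<and> a \<noteq> c \<and> b \<noteq> c"
      if "(a, {b, c}) \<in> U" for a b c using Ud[OF that] by blast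
    show "a \<in> univ S \<and> b \<in> univ S \<and> c \<in> univ S \<and> a \<noteq> b \<and> a \<noteq> c \<and> b \<noteq> c"
      if "(a, {b, c}) \<in> D" for a b c using Dd[OF that] by blast
    show "(a, {d, e}) \<in> U" if "(a, {b, c}) \<in> U" "({b, c}, {d, e}) \<in> L" for a b c d e
      using Um[OF that] .
    show "(a, {b, c}) \<in> D" if "(a, {d, e}) \<in> D" "({b, c}, {d, e}) \<in> L" for a b c d e
      using Dm[OF that] .
  qed (simp_all add: insert_commute)
qed

lemma labeled_switchboard_of:
  assumes "switchboard_of S"
  shows "is_labeled_switchboard S"
proof -
  interpret switchboard "univ S" "on4 (univ S) (lt S)" "on3 (univ S) (up S)" "on3 (univ S) (dn S)"
    by (rule assms)
  let ?A = "univ S" and ?L = "on4 (univ S) (lt S)" and ?U = "on3 (univ S) (up S)" and ?D = "on3 (univ S) (dn S)"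
  define L where "L = {({a, b}, {c, d}) | a b c d. ?L a b c d}"
  define U where "U = {(a, {b, c}) | a b c. ?U a b c}"
  define D where "D = {(a, {b, c}) | a b c. ?D a b c}"
  have L: "({a, b}, {c, d}) \<in> L \<longleftrightarrow> ?L a b c d" for a b c d
    unfolding L_def using L_swap1 L_swap2 by (auto simp: doubleton_eq_iff)
  have U: "(a, {b, c}) \<in> U \<longleftrightarrow> ?U a b c" for a b c
    unfolding U_def using U_swap by (auto simp: doubleton_eq_iff)
  have D: "(a, {b, c}) \<in> D \<longleftrightarrow> ?D a b c" for a b c
    unfolding D_def using D_swap by (auto simp: doubleton_eq_iff)
  have Lsub: "L \<subseteq> [?A]\<^bsup>2\<^esup> \<times> [?A]\<^bsup>2\<^esup>"
    using L_dom L_neq by (force simp: L_def)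
  have irr: "irrefl L"
  proof (rule irreflI)
    fix p show "(p, p) \<notin> L"
    proof
      assume p: "(p, p) \<in> L"
      then have "p \<in> [?A]\<^bsup>2\<^esup>" using Lsub by auto
      then obtain x y where xy: "p = {x, y}" by (auto elim: nsets2_E)
      then show False using p L[of x y x y] L_common by auto
    qed
  qed
  have trans: "trans L"
  proof (rule transI)
    fix p q r assume pq: "(p, q) \<in> L" "(q, r) \<in> L"
    then have "p \<in> [?A]\<^bsup>2\<^esup>" "q \<in> [?A]\<^bsup>2\<^esup>" "r \<in> [?A]\<^bsup>2\<^esup>" using Lsub by auto
    then obtain a b c d e f where p: "p = {a, b}" and q: "q = {c, d}" and r: "r = {e, f}"
      by (metis nsets2_E)
    show "(p, r) \<in> L" using pq L_trans unfolding p q r L by blast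
  qed
  have "labeled_switchboard ?A L U D"
    unfolding labeled_switchboard_def
  proof (intro conjI Lsub irr trans ballI impI)
    show "U \<subseteq> ?A \<times> [?A]\<^bsup>2\<^esup>" "D \<subseteq> ?A \<times> [?A]\<^bsup>2\<^esup>"
      using U_dom D_dom by (force simp: U_def D_def)+
    show "({x, y}, {x, z}) \<notin> L" "({x, z}, {x, y}) \<notin> L" for x y z
      using L L_common by auto
    fix a p assume a: "a \<in> ?A" and p: "p \<in> [?A]\<^bsup>2\<^esup>"
    obtain b c where p': "p = {b, c}" "b \<in> ?A" "c \<in> ?A" "b \<noteq> c" using p by (auto elim: nsets2_E)
    show "(a, p) \<in> U \<and> a \<notin> p \<and> (a, p) \<notin> D \<or> (a, p) \<notin> U \<and> a \<in> p \<and> (a, p) \<notin> D \<or>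
        (a, p) \<notin> U \<and> a \<notin> p \<and> (a, p) \<in> D"
      unfolding p'(1) U D using U_or_D[OF a p'(2,3)] p'(4) U_dom[of a b c] D_dom[of a b c] U_D[of a b c] by auto
    fix q assume q: "q \<in> [?A]\<^bsup>2\<^esup>"
    obtain d e where q': "q = {d, e}" using q by (auto elim: nsets2_E)
    show "(a, q) \<in> U" if "(a, p) \<in> U \<and> (p, q) \<in> L"
      using that U_mono unfolding p'(1) q' U L by blast
    show "(a, q) \<in> D" if "(a, p) \<in> D \<and> (q, p) \<in> L"
      using that D_mono unfolding p'(1) q' D L by blast
  qed
  then show ?thesis
    unfolding is_labeled_switchboard_def
    by (intro exI[of _ L] exI[of _ U] exI[of _ D]) (auto simp: L U D on3_def on4_def)
qed

lemma switchboard_pullback: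
  assumes "switchboard B L U D" "inj_on g A" "g ` A \<subseteq> B"
  shows "switchboard A (on4 A (\<lambda>a b c d. L (g a) (g b) (g c) (g d)))
    (on3 A (\<lambda>a b c. U (g a) (g b) (g c))) (on3 A (\<lambda>a b c. D (g a) (g b) (g c)))"
proof -
  interpret switchboard B L U D by (rule assms)
  have g: "g a = g b \<longleftrightarrow> a = b" if "a \<in> A" "b \<in> A" for a b
    using inj_onD[OF assms(2)] that by blast
  have gB: "g a \<in> B" if "a \<in> A" for a using assms(3) that by auto
  show ?thesis
  proof
    show "on4 A (\<lambda>a b c d. L (g a) (g b) (g c) (g d)) a b c d \<longleftrightarrow>
      on4 A (\<lambda>a b c d. L (g a) (g b) (g c) (g d)) b a c d" for a b c d
      using L_swap1 by (auto simp: on4_def)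
    show "on4 A (\<lambda>a b c d. L (g a) (g b) (g c) (g d)) a b c d \<longleftrightarrow>
      on4 A (\<lambda>a b c d. L (g a) (g b) (g c) (g d)) a b d c" for a b c d
      using L_swap2 by (auto simp: on4_def)
    show "on3 A (\<lambda>a b c. U (g a) (g b) (g c)) a b c \<or> on3 A (\<lambda>a b c. D (g a) (g b) (g c)) a b c"
      if "a \<in> A" "b \<in> A" "c \<in> A" "a \<noteq> b" "a \<noteq> c" "b \<noteq> c" for a b c
      using that U_or_D[of "g a" "g b" "g c"] by (simp add: on3_def g gB)
    show "on3 A (\<lambda>a b c. U (g a) (g b) (g c)) a b c \<longleftrightarrow> on3 A (\<lambda>a b c. U (g a) (g b) (g c)) a c b" for a b c
      using U_swap by (auto simp: on3_def)
    show "on3 A (\<lambda>a b c. D (g a) (g b) (g c)) a b c \<longleftrightarrow> on3 A (\<lambda>a b c. D (g a) (g b) (g c)) a c b" for a b c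
      using D_swap by (auto simp: on3_def)
  qed (unfold on3_def on4_def; use L_common in \<open>blast dest: L_neq L_trans U_dom D_dom U_D U_mono D_mono\<close>)+
qed

text \<open>Upward closure of the partial labels, all remaining pairs being labeled downwards.\<close>

lemma (in pair_order) extend_labels:
  fixes U D :: "'a \<Rightarrow> 'a \<Rightarrow> 'a \<Rightarrow> bool"
  assumes U_swap: "\<And>a b c. U a b c \<Longrightarrow> U a c b"
    and U_dom: "\<And>a b c. U a b c \<Longrightarrow> a \<in> A \<and> b \<in> A \<and> c \<in> A \<and> a \<noteq> b \<and> a \<noteq> c \<and> b \<noteq> c"
    and D_dom: "\<And>a b c. D a b c \<Longrightarrow> a \<in> A \<and> b \<in> A \<and> c \<in> A \<and> a \<noteq> b \<and> a \<noteq> c \<and> b \<noteq> c"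
    and U_D: "\<And>a b c. U a b c \<Longrightarrow> \<not> D a b c"
    and consistent: "\<And>a b c d e. L b c d e \<Longrightarrow> U a b c \<or> a = b \<or> a = c \<Longrightarrow>
      D a d e \<or> a = d \<or> a = e \<Longrightarrow> False"
  obtains U' D' where "switchboard A L U' D'" "\<And>a b c. U a b c \<Longrightarrow> U' a b c"
    "\<And>a b c. D a b c \<Longrightarrow> D' a b c"
proof -
  define ok where "ok a b c \<longleftrightarrow> a \<in> A \<and> b \<in> A \<and> c \<in> A \<and> a \<noteq> b \<and> a \<noteq> c \<and> b \<noteq> c" for a b c
  \<comment> \<open>Membership acts as an up label: if \<open>a\<close> lies in \<open>p\<close> and
    \<open>p < q\<close>, then \<open>a\<close> is not in \<open>q\<close> by incomparability, and a
    down label at \<open>q\<close> would force one at \<open>p\<close>. Hence \<open>a\<close> must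
    be up at \<open>q\<close>.\<close>
  define V where "V a b c \<longleftrightarrow> U a b c \<or> a = b \<or> a = c" for a b c
  define U' where "U' a b c \<longleftrightarrow> ok a b c \<and> (U a b c \<or> (\<exists>d e. V a d e \<and> L d e b c))" for a b c
  define D' where "D' a b c \<longleftrightarrow> ok a b c \<and> \<not> U' a b c" for a b c
  have ok_swap: "ok a c b" if "ok a b c" for a b c using that by (auto simp: ok_def)
  have U'_swap: "U' a c b" if "U' a b c" for a b c
    using that ok_swap U_swap L_swap2 unfolding U'_def by blast
  have lower: "\<exists>d' e'. V a d' e' \<and> L d' e' d e" if "U' a b c" "L b c d e" for a b c d e
    using that L_trans unfolding U'_def V_def by blast
  have U'_mono: "U' a d e" if "U' a b c" "L b c d e" for a b c d e
  proof -
    obtain d' e' where "V a d' e'" "L d' e' d e" using lower[OF \<open>U' a b c\<close> \<open>L b c d e\<close>] by blast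
    moreover from this have "a \<noteq> d" "a \<noteq> e" using consistent[of d' e' d e a] by (auto simp: V_def)
    moreover have "a \<in> A" using that by (auto simp: U'_def ok_def)
    ultimately show ?thesis using L_dom[of d' e' d e] L_neq[of d' e' d e] unfolding U'_def ok_def by blast
  qed
  have D'_mono: "D' a b c" if "D' a d e" "L b c d e" for a b c d e
  proof -
    have "\<not> V a b c" using that unfolding D'_def U'_def by blast
    moreover have "\<not> U' a b c" using U'_mono that unfolding D'_def by blast
    ultimately show ?thesis
      using L_dom[OF that(2)] L_neq[OF that(2)] that(1) unfolding D'_def ok_def V_def by blast
  qed
  have "switchboard A L U' D'"
  proof
    show "U' a b c \<longleftrightarrow> U' a c b" for a b c using U'_swap by blast
    show "D' a b c \<longleftrightarrow> D' a c b" for a b c using U'_swap ok_swap unfolding D'_def by blast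
    show "U' a d e" if "U' a b c" "L b c d e" for a b c d e using U'_mono that .
    show "D' a b c" if "D' a d e" "L b c d e" for a b c d e using D'_mono that .
  qed (auto simp: U'_def D'_def ok_def)
  moreover have "U' a b c" if "U a b c" for a b c
    using that U_dom[OF that] unfolding U'_def ok_def by blast
  moreover have "D' a b c" if "D a b c" for a b c
  proof -
    have "\<not> U a b c" using U_D that by blast
    moreover have "\<not> (\<exists>d e. V a d e \<and> L d e b c)" using consistent that unfolding V_def by blast
    ultimately show ?thesis using D_dom[OF that] unfolding D'_def U'_def ok_def by blast
  qed
  ultimately show thesis by (rule that)
qed

section \<open>The cyclic amalgam\<close>

text \<open>The consistency condition of \<open>extend_labels\<close>, for the full labels of a
  switchboard. Clashes of partial labels in the amalgam are refuted by reading them as such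
  configurations among \<open>b0\<close>, \<open>b1\<close>, \<open>b2\<close> and
  \<open>C\<close>.\<close>

lemma (in switchboard) labels_consistent:
  assumes "L b c d e" "U a b c \<or> a = b \<or> a = c" "D a d e \<or> a = d \<or> a = e"
  shows False
proof -
  have "\<not> (a = d \<or> a = e)" if "U a b c" using U_mono[OF that assms(1)] U_dom by blast
  moreover have "\<not> D a d e" if "U a b c" using U_mono[OF that assms(1)] U_D by blast
  moreover have "\<not> (a = b \<or> a = c)" if "D a d e" using D_mono[OF that assms(1)] D_dom by blast
  moreover have "\<not> ((a = b \<or> a = c) \<and> (a = d \<or> a = e))"
    using assms(1) L_common L_swap1 L_swap2 by metis
  ultimately show False using assms(2,3) by blast
qed

text \<open>Pairs of points of the amalgam: \<open>CC c e\<close> stands for \<open>{c, e}\<close>, \<open>DC i c\<close> for \<open>{d\<^sub>i, c}\<close>, \<open>DD\<close> for any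
  two neighbours on the cycle and \<open>NN\<close> for any other two points of the cycle, which form a pair
  incomparable to all others.\<close>

datatype 'a pcode = CC 'a 'a | DC int 'a | DD | NN

text \<open>The invariance assumptions are what the amalgam uses of the equality of the types of
  \<open>(b0, b1)\<close>, \<open>(b1, b2)\<close> and \<open>(b0, b2)\<close> over
  \<open>C\<close>.\<close>

locale indiscernible = switchboard A L U D
  for A :: "'a set" and L :: "'a \<Rightarrow> 'a \<Rightarrow> 'a \<Rightarrow> 'a \<Rightarrow> bool" and U D :: "'a \<Rightarrow> 'a \<Rightarrow> 'a \<Rightarrow> bool" +
  fixes C :: "'a set" and b0 b1 b2 :: 'a
  assumes finite_C: "finite C" and C: "C \<subseteq> A"
    and b: "b0 \<in> A" "b1 \<in> A" "b0 \<notin> C" "b1 \<notin> C" "b0 \<noteq> b1"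
    and inv_L: "\<And>c e f. c \<in> C \<Longrightarrow> e \<in> C \<Longrightarrow> f \<in> C \<Longrightarrow> L b1 c e f \<longleftrightarrow> L b0 c e f"
      "\<And>c e f. c \<in> C \<Longrightarrow> e \<in> C \<Longrightarrow> f \<in> C \<Longrightarrow> L e f b1 c \<longleftrightarrow> L e f b0 c"
    and inv_L12: "\<And>c e. c \<in> C \<Longrightarrow> e \<in> C \<Longrightarrow> L b1 c b2 e \<longleftrightarrow> L b0 c b1 e"
      "\<And>c e. c \<in> C \<Longrightarrow> e \<in> C \<Longrightarrow> L b2 c b1 e \<longleftrightarrow> L b1 c b0 e"
    and inv_L02: "\<And>c e. c \<in> C \<Longrightarrow> e \<in> C \<Longrightarrow> L b0 c b2 e \<longleftrightarrow> L b0 c b1 e"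
      "\<And>c e. c \<in> C \<Longrightarrow> e \<in> C \<Longrightarrow> L b2 c b0 e \<longleftrightarrow> L b1 c b0 e"
    and inv_U: "\<And>c e. c \<in> C \<Longrightarrow> e \<in> C \<Longrightarrow> U c b1 e \<longleftrightarrow> U c b0 e"
      "\<And>c e. c \<in> C \<Longrightarrow> e \<in> C \<Longrightarrow> U b1 c e \<longleftrightarrow> U b0 c e"
      "\<And>c. c \<in> C \<Longrightarrow> U b1 b2 c \<longleftrightarrow> U b0 b1 c"
    and inv_D: "\<And>c e. c \<in> C \<Longrightarrow> e \<in> C \<Longrightarrow> D c b1 e \<longleftrightarrow> D c b0 e"
      "\<And>c e. c \<in> C \<Longrightarrow> e \<in> C \<Longrightarrow> D b1 c e \<longleftrightarrow> D b0 c e"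
      "\<And>c. c \<in> C \<Longrightarrow> D b1 b2 c \<longleftrightarrow> D b0 b1 c"
begin

text \<open>Distances in the cyclic order are bounded by rank differences, hence by
  \<open>card C = n - 3\<close>. This keeps out \<open>n - 1\<close> and \<open>n - 2\<close>, which
  are one and two steps in the opposite direction. Moreover \<open>n \<ge> 3\<close> prevents two
  points from being successors of each other.\<close>

definition n :: int where "n = int (card C) + 3"

text \<open>By indiscernibility, \<open>fw\<close> and \<open>bw\<close> tell when \<open>{b\<^sub>i, c} < {b\<^sub>j, e}\<close> holds for \<open>i < j\<close> and for
  \<open>j < i\<close>.\<close>

definition fw :: "'a \<Rightarrow> 'a \<Rightarrow> bool" where "fw c e \<longleftrightarrow> c \<in> C \<and> e \<in> C \<and> L b0 c b1 e"
definition bw :: "'a \<Rightarrow> 'a \<Rightarrow> bool" where "bw c e \<longleftrightarrow> c \<in> C \<and> e \<in> C \<and> L b1 c b0 e"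

text \<open>A height on \<open>C\<close> that increases along \<open>fw\<close> and
  \<open>bw\<close> alike and never exceeds \<open>card C\<close>; it measures how much further a
  chain may run.\<close>

definition rank :: "'a \<Rightarrow> int" where "rank c = int (card {x \<in> C. fw x c \<or> bw x c})"

lemma L_common': "\<not> L a b c a" "\<not> L b a a c" "\<not> L b a c a" "\<not> L a b a c"
proof -
  show "\<not> L a b a c" by (rule L_common)
  show "\<not> L a b c a" unfolding L_swap2[of a b c a] by (rule L_common)
  show "\<not> L b a a c" unfolding L_swap1[of b a a c] by (rule L_common)
  show "\<not> L b a c a" unfolding L_swap1[of b a c a] L_swap2[of a b c a] by (rule L_common)
qed

text \<open>The steps from \<open>b0\<close> to \<open>b1\<close> and from \<open>b1\<close> to
  \<open>b2\<close> compose to one from \<open>b0\<close> to \<open>b2\<close>, and that pair has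
  the type of \<open>(b0, b1)\<close>.\<close>

lemma fw_trans:
  assumes "fw c e" "fw e f"
  shows "fw c f"
proof -
  have "c \<in> C" "e \<in> C" "f \<in> C" "L b0 c b1 e" "L b0 e b1 f" using assms by (auto simp: fw_def)
  moreover from this have "L b0 c b2 f" using L_trans[of b0 c b1 e b2 f] by (simp add: inv_L12)
  ultimately show ?thesis by (simp add: fw_def inv_L02)
qed

lemma bw_trans:
  assumes "bw c e" "bw e f"
  shows "bw c f"
proof -
  have "c \<in> C" "e \<in> C" "f \<in> C" "L b1 c b0 e" "L b1 e b0 f" using assms by (auto simp: bw_def)
  moreover from this have "L b2 c b0 f" using L_trans[of b2 c b1 e b0 f] by (simp add: inv_L12)
  ultimately show ?thesis by (simp add: bw_def inv_L02)
qed

text \<open>A step followed by one in the other direction would compare two pairs that share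
  \<open>b0\<close>, or \<open>b1\<close>. So chains never turn round.\<close>

lemma fw_bw: "fw c e \<Longrightarrow> \<not> bw e f" "bw c e \<Longrightarrow> \<not> fw e f"
  unfolding bw_def fw_def using L_trans L_common' by blast+

lemma fw_irrefl: "\<not> fw c c" "\<not> bw c c"
  unfolding bw_def fw_def using L_common' by blast+

text \<open>By \<open>fw_bw\<close> a predecessor of \<open>c\<close> reaches \<open>c\<close> in
  the direction in which \<open>c\<close> precedes \<open>e\<close>, so transitivity makes it a
  predecessor of \<open>e\<close>; and \<open>c\<close> itself is a new one.\<close>

lemma rank_less:
  assumes "fw c e \<or> bw c e"
  shows "rank c < rank e"
proof -
  have "{x \<in> C. fw x c \<or> bw x c} \<subset> {x \<in> C. fw x e \<or> bw x e}"
  proof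
    show "{x \<in> C. fw x c \<or> bw x c} \<subseteq> {x \<in> C. fw x e \<or> bw x e}"
      using assms fw_trans bw_trans fw_bw by blast
    have "c \<in> C" using assms unfolding fw_def bw_def by blast
    then show "{x \<in> C. fw x c \<or> bw x c} \<noteq> {x \<in> C. fw x e \<or> bw x e}"
      using assms fw_irrefl by blast
  qed
  then show ?thesis unfolding rank_def using finite_C by (simp add: psubset_card_mono)
qed

lemma rank_diff: "rank e - rank c \<le> n - 3"
proof -
  have "card {x \<in> C. fw x e \<or> bw x e} \<le> card C" using finite_C by (intro card_mono) auto
  then show ?thesis unfolding rank_def n_def by linarith
qed

section \<open>Distance on the cycle and the order between pairs of a cycle point and a
  parameter\<close>

definition gap :: "int \<Rightarrow> int \<Rightarrow> int" where "gap i j = (j - i) mod n"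

lemma n_ge: "n \<ge> 3" by (simp add: n_def)

lemma gap_bounds: "0 \<le> gap i j" "gap i j < n"
  using n_ge by (simp_all add: gap_def)

lemma gap_refl [simp]: "gap i i = 0" by (simp add: gap_def)

lemma gap_add: "gap i k = (gap i j + gap j k) mod n"
proof -
  have "k - i = (j - i) + (k - j)" by simp
  then show ?thesis unfolding gap_def by (metis mod_add_eq)
qed

lemma gap_cases: "gap i k = gap i j + gap j k \<or> gap i k = gap i j + gap j k - n"
proof -
  let ?s = "gap i j + gap j k"
  have b: "0 \<le> ?s" "?s < 2 * n" using gap_bounds[of i j] gap_bounds[of j k] by auto
  show ?thesis
  proof (cases "?s < n")
    case True
    then show ?thesis using gap_add[of i k j] b by simp
  next
    case False
    then have "?s mod n = (?s - n) mod n" by simp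
    also have "\<dots> = ?s - n" using b False by (intro mod_pos_pos_trivial) auto
    finally show ?thesis using gap_add[of i k j] by simp
  qed
qed

lemma gap_swap: "gap i j = 0 \<and> gap j i = 0 \<or> gap i j > 0 \<and> gap j i = n - gap i j"
  using gap_cases[of i i j] gap_bounds[of i j] gap_bounds[of j i] by auto

text \<open>The order between \<open>{d\<^sub>i, c}\<close> and \<open>{d\<^sub>j, e}\<close>. Transitivity forces relations between points
  further apart than neighbours; bounding the distance by the difference in rank keeps it
  transitive without ever going around the cycle.\<close>

definition cyc_less :: "int \<Rightarrow> int \<Rightarrow> 'a \<Rightarrow> 'a \<Rightarrow> bool" where
  "cyc_less i j c e \<longleftrightarrow> fw c e \<and> 1 \<le> gap i j \<and> gap i j \<le> rank e - rank c \<or>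
     bw c e \<and> 1 \<le> gap j i \<and> gap j i \<le> rank e - rank c"

text \<open>Both steps have the same direction by \<open>fw_bw\<close>. The sum of their distances
  is at most the total rank difference, hence below \<open>n\<close>, so the second alternative of
  \<open>gap_cases\<close> cannot occur.\<close>

lemma cyc_less_trans: "cyc_less i j c e \<Longrightarrow> cyc_less j k e f \<Longrightarrow> cyc_less i k c f"
  unfolding cyc_less_def
  using fw_trans[of c e f] bw_trans[of c e f] fw_bw[of c e f] gap_cases[of i k j] gap_cases[of k i j]
    rank_diff[of f c] gap_bounds[of i k] gap_bounds[of k i]
  by linarith

lemma cyc_less_C: "cyc_less i j c e \<Longrightarrow> c \<in> C \<and> e \<in> C"
  by (auto simp: cyc_less_def fw_def bw_def)

lemma cyc_less_L:
  assumes "cyc_less i j c e"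
  shows "L b0 c b1 e \<or> L b1 c b0 e"
  using assms by (auto simp: cyc_less_def fw_def bw_def)

lemma cyc_less_refl: "\<not> cyc_less i i c e"
  by (simp add: cyc_less_def)

text \<open>A single step raises the rank by at least one, so distance 1 is always within the bound;
  the distance \<open>n - 1\<close> the other way round never is.\<close>

lemma cyc_less_Suc:
  assumes "gap i j = 1" "c \<in> C" "e \<in> C"
  shows "cyc_less i j c e \<longleftrightarrow> L b0 c b1 e" "cyc_less j i c e \<longleftrightarrow> L b1 c b0 e"
proof -
  have "gap j i = n - 1" using gap_swap[of i j] assms by auto
  then show "cyc_less i j c e \<longleftrightarrow> L b0 c b1 e" "cyc_less j i c e \<longleftrightarrow> L b1 c b0 e"
    using assms rank_diff[of e c] n_ge rank_less[of c e] unfolding cyc_less_def by (auto simp: fw_def bw_def)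
qed

text \<open>The way round of length \<open>n - 2\<close> exceeds every rank difference, which fixes
  the direction. This serves the labels of the point in the middle, whose two neighbours are two
  steps apart.\<close>

lemma cyc_less_Suc_Suc:
  assumes "gap i j = 1" "gap j k = 1"
  shows "cyc_less i k c e \<Longrightarrow> L b0 c b1 e" "cyc_less k i c e \<Longrightarrow> L b1 c b0 e"
proof -
  have "gap i k = 2" using gap_cases[of i k j] gap_bounds[of i k] assms n_ge by auto
  moreover from this have "gap k i = n - 2" using gap_swap[of i k] by auto
  ultimately show "cyc_less i k c e \<Longrightarrow> L b0 c b1 e" "cyc_less k i c e \<Longrightarrow> L b1 c b0 e"
    using rank_diff[of e c] n_ge unfolding cyc_less_def by (auto simp: fw_def bw_def)
qed

lemma not_cyc_less_of_gap_0: "gap i j = 0 \<Longrightarrow> \<not> cyc_less i j c e"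
  using gap_swap[of i j] by (auto simp: cyc_less_def)

section \<open>Order and partial labels on codes of pairs\<close>

fun pcode_of :: "'a + int \<Rightarrow> 'a + int \<Rightarrow> 'a pcode" where
  "pcode_of (Inl a) (Inl b) = CC a b"
| "pcode_of (Inl a) (Inr i) = DC i a"
| "pcode_of (Inr i) (Inl a) = DC i a"
| "pcode_of (Inr i) (Inr j) = (if gap i j = 1 \<or> gap j i = 1 then DD else NN)"

text \<open>Against pairs from \<open>C\<close>, the point \<open>b0\<close> stands for every cycle
  point and \<open>b0\<close>, \<open>b1\<close> for any two neighbours. A pair of neighbours is
  compared with pairs from \<open>C\<close> only, since no chart relates it to a pair
  \<open>{d, c}\<close>: inside a chart the two share a point.\<close>

fun pcode_of_less :: "'a pcode \<Rightarrow> 'a pcode \<Rightarrow> bool" where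
  "pcode_of_less (CC a b) (CC c d) \<longleftrightarrow> a \<in> C \<and> b \<in> C \<and> c \<in> C \<and> d \<in> C \<and> L a b c d"
| "pcode_of_less (CC a b) (DC i c) \<longleftrightarrow> a \<in> C \<and> b \<in> C \<and> c \<in> C \<and> L a b b0 c"
| "pcode_of_less (CC a b) DD \<longleftrightarrow> a \<in> C \<and> b \<in> C \<and> L a b b0 b1"
| "pcode_of_less (DC i c) (CC a b) \<longleftrightarrow> a \<in> C \<and> b \<in> C \<and> c \<in> C \<and> L b0 c a b"
| "pcode_of_less DD (CC a b) \<longleftrightarrow> a \<in> C \<and> b \<in> C \<and> L b0 b1 a b"
| "pcode_of_less (DC i c) (DC j e) \<longleftrightarrow> cyc_less i j c e"
| "pcode_of_less _ _ \<longleftrightarrow> False"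

lemma cyc_less_below:
  assumes "cyc_less i j c e" "a \<in> C" "b \<in> C"
  shows "L b0 e a b \<Longrightarrow> L b0 c a b" "L a b b0 c \<Longrightarrow> L a b b0 e"
proof -
  have C: "c \<in> C" "e \<in> C" using cyc_less_C[OF assms(1)] by blast+
  note inv = inv_L(1)[OF C(1) assms(2,3)] inv_L(1)[OF C(2) assms(2,3)]
    inv_L(2)[OF C(1) assms(2,3)] inv_L(2)[OF C(2) assms(2,3)]
  show "L b0 e a b \<Longrightarrow> L b0 c a b"
    using cyc_less_L[OF assms(1)] inv L_trans[of b0 c b1 e a b] L_trans[of b1 c b0 e a b] by blast
  show "L a b b0 c \<Longrightarrow> L a b b0 e"
    using cyc_less_L[OF assms(1)] inv L_trans[of a b b0 c b1 e] L_trans[of a b b1 c b0 e] by blast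
qed

lemma L_no_return: "L x y u v \<Longrightarrow> \<not> L u v x w"
  using L_trans L_common by blast

text \<open>A pair from \<open>C\<close> never lies between two pairs meeting the cycle: read in the
  original switchboard, both would contain \<open>b0\<close> and yet be comparable. So going through
  \<open>C\<close> forces no new relation on the cycle, and what remains is
  \<open>cyc_less_trans\<close> and the invariance of comparisons with pairs from
  \<open>C\<close>.\<close>

lemma pcode_of_less_trans: "pcode_of_less p q \<Longrightarrow> pcode_of_less q r \<Longrightarrow> pcode_of_less p r"
  by (cases p; cases q; cases r; simp; metis L_trans L_no_return cyc_less_below cyc_less_trans cyc_less_C)

lemma pcode_of_less_swap: "pcode_of_less (pcode_of x y) p \<longleftrightarrow> pcode_of_less (pcode_of y x) p" "pcode_of_less p (pcode_of x y) \<longleftrightarrow> pcode_of_less p (pcode_of y x)"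
  using L_swap1 L_swap2 by (cases x; cases y; cases p; auto)+

lemma pcode_of_less_neq: "pcode_of_less (pcode_of x y) p \<Longrightarrow> x \<noteq> y" "pcode_of_less p (pcode_of x y) \<Longrightarrow> x \<noteq> y"
  using L_neq by (cases x; cases y; cases p; force)+

lemma pcode_of_less_common: "\<not> pcode_of_less (pcode_of x y) (pcode_of x z)"
  by (cases x; cases y; cases z) (auto simp: L_common' cyc_less_refl cyc_less_def fw_irrefl)

text \<open>\<open>DD\<close> and \<open>NN\<close> forget the points, so \<open>in_code\<close> only over-approximates membership.\<close>

fun in_code :: "'a + int \<Rightarrow> 'a pcode \<Rightarrow> bool" where
  "in_code (Inl c) (CC a b) \<longleftrightarrow> c = a \<or> c = b"
| "in_code (Inl c) (DC i a) \<longleftrightarrow> c = a"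
| "in_code (Inl c) _ \<longleftrightarrow> False"
| "in_code (Inr i) (CC a b) \<longleftrightarrow> False"
| "in_code (Inr i) (DC j a) \<longleftrightarrow> i = j"
| "in_code (Inr i) _ \<longleftrightarrow> True"

lemma in_code_pcode_of: "in_code x (pcode_of x y)" "in_code x (pcode_of y x)"
  by (cases x; cases y; auto)+

text \<open>Exactly the labels visible in a chart are prescribed: a cycle point is labeled against
  \<open>{d, a}\<close> only if \<open>d\<close> is its neighbour, and three cycle points get no
  label here.\<close>

fun pcode_of_label :: "('a \<Rightarrow> 'a \<Rightarrow> 'a \<Rightarrow> bool) \<Rightarrow> 'a + int \<Rightarrow> 'a pcode \<Rightarrow> bool" where
  "pcode_of_label R (Inl c) (CC a b) \<longleftrightarrow> c \<in> C \<and> a \<in> C \<and> b \<in> C \<and> R c a b"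
| "pcode_of_label R (Inl c) (DC i a) \<longleftrightarrow> c \<in> C \<and> a \<in> C \<and> R c b0 a"
| "pcode_of_label R (Inl c) DD \<longleftrightarrow> c \<in> C \<and> R c b0 b1"
| "pcode_of_label R (Inr i) (CC a b) \<longleftrightarrow> a \<in> C \<and> b \<in> C \<and> R b0 a b"
| "pcode_of_label R (Inr i) (DC j a) \<longleftrightarrow> a \<in> C \<and> (gap i j = 1 \<and> R b0 b1 a \<or> gap j i = 1 \<and> R b1 b0 a)"
| "pcode_of_label R _ _ \<longleftrightarrow> False"

lemma pcode_of_label_swap:
  assumes "\<And>a b c. R a b c \<longleftrightarrow> R a c b"
  shows "pcode_of_label R x (pcode_of y z) \<longleftrightarrow> pcode_of_label R x (pcode_of z y)"
  using assms by (cases x; cases y; cases z) auto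

lemma pcode_of_label_U_D: "pcode_of_label U x p \<Longrightarrow> \<not> pcode_of_label D x p"
proof -
  have "\<not> (gap i j = 1 \<and> gap j i = 1)" for i j using gap_swap[of i j] n_ge by auto
  then show "pcode_of_label U x p \<Longrightarrow> \<not> pcode_of_label D x p"
    by (cases x; cases p) (auto dest: U_D)
qed

lemma pcode_of_label_mem:
  assumes "\<And>a b c. R a b c \<Longrightarrow> a \<noteq> b \<and> a \<noteq> c"
  shows "pcode_of_label R x p \<Longrightarrow> \<not> in_code x p"
  by (cases x; cases p) (auto dest: assms)

text \<open>Cycle points are read as \<open>b0\<close>, \<open>b1\<close>, \<open>b2\<close>, so
  that a clash becomes one in the original switchboard. The delicate case has \<open>x\<close> on
  the cycle with \<open>p\<close> and \<open>q\<close> at its two different neighbours; this is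
  where relations over distance two and the third point come in.\<close>

lemma pcode_of_less_consistent:
  assumes "pcode_of_less p q" "pcode_of_label U x p \<or> in_code x p" "pcode_of_label D x q \<or> in_code x q"
  shows False
proof (cases x)
  case (Inl c)
  show ?thesis
  proof (cases "\<exists>i e j f. p = DC i e \<and> q = DC j f")
    case True
    then obtain i e j f where pq: "p = DC i e" "q = DC j f" by blast
    then have ef: "e \<in> C" "f \<in> C" using assms(1) cyc_less_C by auto
    have "U c b0 e \<or> c = e" "U c b1 e \<or> c = e" "D c b0 f \<or> c = f" "D c b1 f \<or> c = f"
      using assms(2,3) ef inv_U(1) inv_D(1) by (auto simp: Inl pq)
    then show ?thesis
      using labels_consistent[of b0 e b1 f c] labels_consistent[of b1 e b0 f c] cyc_less_L[of i j e f] assms(1)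
      by (auto simp: pq)
  next
    case False
    then show ?thesis using assms labels_consistent[of _ _ _ _ c]
      by (cases p; cases q) (auto simp: Inl)
  qed
next
  case (Inr k)
  show ?thesis
  proof (cases "\<exists>i e j f. p = DC i e \<and> q = DC j f")
    case True
    then obtain i e j f where pq: "p = DC i e" "q = DC j f" by blast
    then have r: "cyc_less i j e f" and ef: "e \<in> C" "f \<in> C" using assms(1) cyc_less_C by auto
    consider "i = k" | "gap k i = 1" "U b0 b1 e" | "gap i k = 1" "U b1 b0 e"
      using assms(2) by (auto simp: pq Inr)
    then show ?thesis
    proof cases
      case 1
      consider "j = k" | "gap k j = 1" "D b0 b1 f" | "gap j k = 1" "D b1 b0 f"
        using assms(3) by (auto simp: pq Inr)
      then show ?thesis
      proof cases
        case 1
        then show ?thesis using r \<open>i = k\<close> cyc_less_refl by simp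
      next
        case 2
        then show ?thesis using r \<open>i = k\<close> ef cyc_less_Suc(1)[of k j e f] labels_consistent[of b0 e b1 f b0] by simp
      next
        case 3
        then show ?thesis using r \<open>i = k\<close> ef cyc_less_Suc(2)[of j k e f] labels_consistent[of b1 e b0 f b1] by simp
      qed
    next
      case 2
      consider "j = k" | "gap k j = 1" | "gap j k = 1" "D b1 b0 f"
        using assms(3) by (auto simp: pq Inr)
      then show ?thesis
      proof cases
        case 1
        then show ?thesis using r 2 ef cyc_less_Suc(2)[of k i e f] labels_consistent[of b1 e b0 f b0] by simp
      next
        case 2
        \<comment> \<open>Here \<open>i\<close> and \<open>j\<close> are arbitrary integers, so two
          successors of \<open>k\<close> agree only modulo \<open>n\<close>.\<close>
        have "gap i j = 0"
          using gap_cases[of k j i] gap_bounds[of i j] \<open>gap k i = 1\<close> 2 by auto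
        then show ?thesis using r not_cyc_less_of_gap_0 by blast
      next
        case 3
        \<comment> \<open>The points at \<open>j\<close>, \<open>k\<close>, \<open>i\<close> are
          consecutive and are read as \<open>b0\<close>, \<open>b1\<close>, \<open>b2\<close>. The
          mirror case below reads \<open>i\<close>, \<open>k\<close>, \<open>j\<close> in this
          way.\<close>
        have "L b1 e b0 f" using cyc_less_Suc_Suc(2)[OF 3(1) 2(1)] r by blast
        then have "L b2 e b0 f" using inv_L02(2) ef by blast
        moreover have "U b1 b2 e" using inv_U(3) ef 2 by blast
        ultimately show ?thesis using 3 labels_consistent[of b2 e b0 f b1] by blast
      qed
    next
      case 3
      consider "j = k" | "gap k j = 1" "D b0 b1 f" | "gap j k = 1"
        using assms(3) by (auto simp: pq Inr)
      then show ?thesis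
      proof cases
        case 1
        then show ?thesis using r 3 ef cyc_less_Suc(1)[of i k e f] labels_consistent[of b0 e b1 f b1] by simp
      next
        case 2
        have "L b0 e b1 f" using cyc_less_Suc_Suc(1)[OF 3(1) 2(1)] r by blast
        then have "L b0 e b2 f" using inv_L02(1) ef by blast
        moreover have "D b1 b2 f" using inv_D(3) ef 2 by blast
        ultimately show ?thesis using 3 labels_consistent[of b0 e b2 f b1] by blast
      next
        case 3
        have "gap i j = 0"
          using gap_cases[of i j k] gap_bounds[of i j] \<open>gap i k = 1\<close> \<open>gap j k = 1\<close>
            gap_swap[of j k] by auto
        then show ?thesis using r not_cyc_less_of_gap_0 by blast
      qed
    qed
  next
    case False
    show ?thesis
    proof (cases "\<exists>a c. p = CC a c")
      case True
      then obtain a c where p: "p = CC a c" by blast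
      have ac: "a \<in> C" "c \<in> C" "U b0 a c"
        using assms(1,2) by (cases q; auto simp: p Inr)+
      have con: "\<not> D b0 d e \<and> b0 \<noteq> d \<and> b0 \<noteq> e" if "L a c d e" for d e
        using labels_consistent[OF that, of b0] ac(3) by blast
      show ?thesis
        using assms(1,3) by (cases q) (auto simp: p Inr dest: con)
    next
      case F2: False
      obtain a c where q: "q = CC a c" using False F2 assms(1) by (cases p; cases q) auto
      have ac: "a \<in> C" "c \<in> C" "D b0 a c"
        using assms(1,3) by (cases p; auto simp: q Inr)+
      have con: "\<not> U b0 d e \<and> b0 \<noteq> d \<and> b0 \<noteq> e" if "L d e a c" for d e
        using labels_consistent[OF that, of b0] ac(3) by blast
      show ?thesis
        using assms(1,2) F2 by (cases p) (auto simp: q Inr dest: con)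
    qed
  qed
qed

section \<open>The amalgam and its charts\<close>

definition X :: "('a + int) set" where "X = Inl ` C \<union> Inr ` {0..<n}"

definition LX :: "'a + int \<Rightarrow> 'a + int \<Rightarrow> 'a + int \<Rightarrow> 'a + int \<Rightarrow> bool" where
  "LX = on4 X (\<lambda>x y u v. pcode_of_less (pcode_of x y) (pcode_of u v))"

lemma finite_X: "finite X"
  using finite_C by (simp add: X_def)

lemma pair_order_X: "pair_order X LX"
  unfolding LX_def on4_def
proof
  show "(x \<in> X \<and> y \<in> X \<and> u \<in> X \<and> v \<in> X \<and> pcode_of_less (pcode_of x y) (pcode_of u v)) \<longleftrightarrow>
      (y \<in> X \<and> x \<in> X \<and> u \<in> X \<and> v \<in> X \<and> pcode_of_less (pcode_of y x) (pcode_of u v))" for x y u v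
    using pcode_of_less_swap(1) by blast
  show "(x \<in> X \<and> y \<in> X \<and> u \<in> X \<and> v \<in> X \<and> pcode_of_less (pcode_of x y) (pcode_of u v)) \<longleftrightarrow>
      (x \<in> X \<and> y \<in> X \<and> v \<in> X \<and> u \<in> X \<and> pcode_of_less (pcode_of x y) (pcode_of v u))" for x y u v
    using pcode_of_less_swap(2) by blast
qed (use pcode_of_less_neq pcode_of_less_common pcode_of_less_trans in blast)+

text \<open>The copy of \<open>b0\<close>, \<open>b1\<close> and \<open>C\<close> that starts at
  place \<open>i\<close> of the cycle. All charts agree on \<open>C\<close>, so the copies share
  their parameters.\<close>

definition chart :: "int \<Rightarrow> 'a \<Rightarrow> 'a + int" where
  "chart i a = (if a = b0 then Inr i else if a = b1 then Inr ((i + 1) mod n) else Inl a)"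

lemma gap_Suc: "gap i ((i + 1) mod n) = 1"
  using n_ge unfolding gap_def by (simp add: mod_diff_left_eq)

lemma chart_simps [simp]:
  "chart i b0 = Inr i" "chart i b1 = Inr ((i + 1) mod n)" "c \<in> C \<Longrightarrow> chart i c = Inl c"
  using b by (auto simp: chart_def)

lemma chart_X: "i \<in> {0..<n} \<Longrightarrow> a \<in> insert b0 (insert b1 C) \<Longrightarrow> chart i a \<in> X"
  using n_ge by (auto simp: X_def)

lemma chart_inj: "inj_on (chart i) (insert b0 (insert b1 C))"
proof (rule inj_onI)
  have "i \<noteq> (i + 1) mod n" using gap_Suc[of i] by auto
  then show "a = c" if "a \<in> insert b0 (insert b1 C)" "c \<in> insert b0 (insert b1 C)" "chart i a = chart i c" for a c
    using that by (auto split: if_splits)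
qed

lemma chart_L:
  assumes "i \<in> {0..<n}" and abcd: "a \<in> insert b0 (insert b1 C)" "a' \<in> insert b0 (insert b1 C)"
    "c \<in> insert b0 (insert b1 C)" "c' \<in> insert b0 (insert b1 C)"
  shows "LX (chart i a) (chart i a') (chart i c) (chart i c') \<longleftrightarrow> L a a' c c'"
proof -
  define j where "j = (i + 1) mod n"
  have 1: "gap i j = 1" using gap_Suc by (simp add: j_def)
  note r = cyc_less_Suc[OF 1]
  have sw: "L b1 b0 u v \<longleftrightarrow> L b0 b1 u v" "L u v b1 b0 \<longleftrightarrow> L u v b0 b1"
    "f \<in> C \<Longrightarrow> L f b0 u v \<longleftrightarrow> L b0 f u v" "f \<in> C \<Longrightarrow> L u v f b0 \<longleftrightarrow> L u v b0 f"
    "f \<in> C \<Longrightarrow> L f b1 u v \<longleftrightarrow> L b1 f u v" "f \<in> C \<Longrightarrow> L u v f b1 \<longleftrightarrow> L u v b1 f" for f u v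
    by (rule L_swap1 L_swap2)+
  have same: "\<not> L x x u v" "\<not> L u v x x" for x u v using L_neq by blast+
  have "pcode_of_less (pcode_of (chart i a) (chart i a')) (pcode_of (chart i c) (chart i c')) \<longleftrightarrow> L a a' c c'"
    using abcd
    by (elim insertE)
      (simp_all add: j_def[symmetric] 1 r cyc_less_refl L_common' same inv_L sw)
  then show ?thesis
    using chart_X[OF assms(1)] abcd by (simp add: LX_def on4_def)
qed

definition partial_label :: "('a \<Rightarrow> 'a \<Rightarrow> 'a \<Rightarrow> bool) \<Rightarrow> 'a + int \<Rightarrow> 'a + int \<Rightarrow> 'a + int \<Rightarrow> bool" where
  "partial_label R = on3 X (\<lambda>x y z. pcode_of_label R x (pcode_of y z))"

lemma chart_label:
  assumes "i \<in> {0..<n}" and abc: "a \<in> insert b0 (insert b1 C)" "c \<in> insert b0 (insert b1 C)"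
    "e \<in> insert b0 (insert b1 C)"
    and sw: "\<And>a c e. R a c e \<longleftrightarrow> R a e c" and neq: "\<And>a c e. R a c e \<Longrightarrow> a \<noteq> c \<and> a \<noteq> e \<and> c \<noteq> e"
    and inv: "\<And>c e. c \<in> C \<Longrightarrow> e \<in> C \<Longrightarrow> R c b1 e \<longleftrightarrow> R c b0 e"
      "\<And>c e. c \<in> C \<Longrightarrow> e \<in> C \<Longrightarrow> R b1 c e \<longleftrightarrow> R b0 c e"
    and R: "R a c e"
  shows "partial_label R (chart i a) (chart i c) (chart i e)"
proof -
  define j where "j = (i + 1) mod n"
  have 1: "gap i j = 1" using gap_Suc by (simp add: j_def)
  have sw': "R x b1 b0 \<longleftrightarrow> R x b0 b1" "f \<in> C \<Longrightarrow> R x f b0 \<longleftrightarrow> R x b0 f"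
    "f \<in> C \<Longrightarrow> R x f b1 \<longleftrightarrow> R x b1 f" for f x
    by (rule sw)+
  have "pcode_of_label R (chart i a) (pcode_of (chart i c) (chart i e))"
    using abc R
    by (elim insertE)
      (auto simp: j_def[symmetric] 1 inv sw' dest: neq)
  then show ?thesis
    using chart_X[OF assms(1)] abc by (simp add: partial_label_def on3_def)
qed

lemma partial_label_dom:
  assumes "\<And>a c e. R a c e \<Longrightarrow> a \<noteq> c \<and> a \<noteq> e \<and> c \<noteq> e" "partial_label R x y z"
  shows "x \<in> X \<and> y \<in> X \<and> z \<in> X \<and> x \<noteq> y \<and> x \<noteq> z \<and> y \<noteq> z"
proof -
  have l: "pcode_of_label R x (pcode_of y z)" and X: "x \<in> X" "y \<in> X" "z \<in> X"
    using assms(2) by (auto simp: partial_label_def on3_def)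
  have "\<not> in_code x (pcode_of y z)" using pcode_of_label_mem[of R] assms(1) l by blast
  then have "x \<noteq> y" "x \<noteq> z" using in_code_pcode_of by blast+
  moreover have "y \<noteq> z" using l assms(1) by (cases x; cases y; cases z) fastforce+
  ultimately show ?thesis using X by blast
qed

text \<open>It is enough that the charts carry \<open>U\<close> into \<open>U'\<close> and
  \<open>D\<close> into \<open>D'\<close>: on three distinct points exactly one of the two labels
  holds on either side, and on others none. The order is dealt with in
  \<open>chart_L\<close>.\<close>

theorem cyclic_amalgam:
  obtains U' D' where "switchboard X LX U' D'"
    "\<forall>i\<in>{0..<n}. \<forall>a\<in>insert b0 (insert b1 C). \<forall>c\<in>insert b0 (insert b1 C). \<forall>e\<in>insert b0 (insert b1 C).
       (U' (chart i a) (chart i c) (chart i e) \<longleftrightarrow> U a c e) \<and> (D' (chart i a) (chart i c) (chart i e) \<longleftrightarrow> D a c e)"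
proof -
  interpret X: pair_order X LX by (rule pair_order_X)
  have U3: "a \<noteq> c \<and> a \<noteq> e \<and> c \<noteq> e" if "U a c e" for a c e using U_dom[OF that] by blast
  have D3: "a \<noteq> c \<and> a \<noteq> e \<and> c \<noteq> e" if "D a c e" for a c e using D_dom[OF that] by blast
  have "\<exists>U' D'. switchboard X LX U' D' \<and> (\<forall>x y z. partial_label U x y z \<longrightarrow> U' x y z) \<and>
     (\<forall>x y z. partial_label D x y z \<longrightarrow> D' x y z)"
  proof (rule X.extend_labels[of "partial_label U" "partial_label D"])
    show "partial_label U x z y" if "partial_label U x y z" for x y z
      using that pcode_of_label_swap[of U x y z, OF U_swap] by (auto simp: partial_label_def on3_def)
    show "x \<in> X \<and> y \<in> X \<and> z \<in> X \<and> x \<noteq> y \<and> x \<noteq> z \<and> y \<noteq> z" if "partial_label U x y z" for x y z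
      using partial_label_dom[OF U3 that] .
    show "x \<in> X \<and> y \<in> X \<and> z \<in> X \<and> x \<noteq> y \<and> x \<noteq> z \<and> y \<noteq> z" if "partial_label D x y z" for x y z
      using partial_label_dom[OF D3 that] .
    show "\<not> partial_label D x y z" if "partial_label U x y z" for x y z
      using that pcode_of_label_U_D by (auto simp: partial_label_def on3_def)
    show False if "LX y z u v" "partial_label U x y z \<or> x = y \<or> x = z"
      "partial_label D x u v \<or> x = u \<or> x = v" for x y z u v
      using that pcode_of_less_consistent[of "pcode_of y z" "pcode_of u v" x] in_code_pcode_of
      unfolding LX_def partial_label_def on3_def on4_def by blast
  qed blast
  then obtain U' D' where UD: "switchboard X LX U' D'"
    and U': "\<And>x y z. partial_label U x y z \<Longrightarrow> U' x y z"
    and D': "\<And>x y z. partial_label D x y z \<Longrightarrow> D' x y z" by blast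
  interpret X: switchboard X LX U' D' by (rule UD)
  have A: "a \<in> A" if "a \<in> insert b0 (insert b1 C)" for a using that b C by auto
  have "(U' (chart i a) (chart i c) (chart i e) \<longleftrightarrow> U a c e) \<and> (D' (chart i a) (chart i c) (chart i e) \<longleftrightarrow> D a c e)"
    if i: "i \<in> {0..<n}" and ace: "a \<in> insert b0 (insert b1 C)" "c \<in> insert b0 (insert b1 C)"
      "e \<in> insert b0 (insert b1 C)" for i a c e
  proof -
    have "U' (chart i a) (chart i c) (chart i e)" if "U a c e"
      using U' chart_label[OF i ace U_swap U3 inv_U(1,2) that] by blast
    moreover have "D' (chart i a) (chart i c) (chart i e)" if "D a c e"
      using D' chart_label[OF i ace D_swap D3 inv_D(1,2) that] by blast
    moreover have "\<not> U' (chart i a) (chart i c) (chart i e) \<and> \<not> D' (chart i a) (chart i c) (chart i e)"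
      if "a = c \<or> a = e \<or> c = e"
      using that X.U_dom X.D_dom by blast
    ultimately show ?thesis
      using U_or_D[OF ace[THEN A]] X.U_D U_dom D_dom by blast
  qed
  then show thesis by (intro that[OF UD] ballI)
qed

end

section \<open>Strict chains of solution sets\<close>

text \<open>Members of the age live on \<open>nat\<close>, hence the detour through an enumeration
  \<open>f\<close> of \<open>A\<close> and its inverse \<open>g\<close>.\<close>

lemma switchboard_finite_subset:
  assumes "age S = finite_labeled_switchboards" "finite A" "A \<subseteq> univ S"
  shows "switchboard A (on4 A (lt S)) (on3 A (up S)) (on3 A (dn S))"
proof -
  obtain f where f: "bij_betw f {0..<card A} A" using ex_bij_betw_nat_finite[OF assms(2)] by blast
  define g where "g = the_inv_into {0..<card A} f"
  have fg: "f (g a) = a" if "a \<in> A" for a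
    using f that unfolding g_def bij_betw_def by (simp add: f_the_inv_into_f)
  have g: "inj_on g A" "g ` A \<subseteq> {0..<card A}"
    using bij_betw_the_inv_into[OF f] unfolding g_def bij_betw_def by auto
  define B where "B = \<lparr>univ = {0..<card A}, lt = \<lambda>a b c d. lt S (f a) (f b) (f c) (f d),
    up = \<lambda>a b c. up S (f a) (f b) (f c), dn = \<lambda>a b c. dn S (f a) (f b) (f c)\<rparr>"
  have "embedding f B S"
    using f assms(3) by (auto simp: embedding_def B_def bij_betw_def)
  then have "B \<in> age S" unfolding age_def by (auto simp: B_def)
  then have "switchboard_of B"
    using switchboard_of_labeled assms(1) unfolding finite_labeled_switchboards_def by blast
  from switchboard_pullback[OF this g(1)] g(2)
  have sb: "switchboard A (on4 A (\<lambda>a b c d. on4 (univ B) (lt B) (g a) (g b) (g c) (g d)))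
    (on3 A (\<lambda>a b c. on3 (univ B) (up B) (g a) (g b) (g c)))
    (on3 A (\<lambda>a b c. on3 (univ B) (dn B) (g a) (g b) (g c)))"
    by (simp add: B_def)
  have gA: "g a \<in> univ B" if "a \<in> A" for a using g(2) that by (auto simp: B_def)
  have "on4 A (\<lambda>a b c d. on4 (univ B) (lt B) (g a) (g b) (g c) (g d)) = on4 A (lt S)"
    using gA by (intro ext) (auto simp: on4_def B_def fg)
  moreover have "on3 A (\<lambda>a b c. on3 (univ B) (up B) (g a) (g b) (g c)) = on3 A (up S)"
    "on3 A (\<lambda>a b c. on3 (univ B) (dn B) (g a) (g b) (g c)) = on3 A (dn S)"
    using gA by (intro ext; auto simp: on3_def B_def fg)+
  ultimately show ?thesis using sb by simp
qed

lemma switchboard_embeds: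
  assumes "age S = finite_labeled_switchboards" "finite A" "switchboard A L U D"
  obtains g where "embedding g \<lparr>univ = A, lt = L, up = U, dn = D\<rparr> S"
proof -
  obtain f where f: "bij_betw f {0..<card A} A" using ex_bij_betw_nat_finite[OF assms(2)] by blast
  define g where "g = the_inv_into {0..<card A} f"
  have fg: "f (g a) = a" if "a \<in> A" for a
    using f that unfolding g_def bij_betw_def by (simp add: f_the_inv_into_f)
  have g: "inj_on g A" "g ` A \<subseteq> {0..<card A}"
    using bij_betw_the_inv_into[OF f] unfolding g_def bij_betw_def by auto
  define B where "B = \<lparr>univ = {0..<card A}, lt = \<lambda>a b c d. L (f a) (f b) (f c) (f d),
    up = \<lambda>a b c. U (f a) (f b) (f c), dn = \<lambda>a b c. D (f a) (f b) (f c)\<rparr>"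
  have "switchboard_of B"
    using switchboard_pullback[OF assms(3), of f "{0..<card A}"] f
    by (simp add: B_def bij_betw_def)
  then have "B \<in> age S"
    using labeled_switchboard_of[of B] unfolding assms(1) finite_labeled_switchboards_def
    by (auto simp: B_def)
  then obtain e where e: "embedding e B S" unfolding age_def by blast
  have "embedding g \<lparr>univ = A, lt = L, up = U, dn = D\<rparr> B"
    using g fg by (auto simp: embedding_def B_def)
  from partial_iso_comp[OF partial_iso_embedding[OF this subset_refl] partial_iso_embedding[OF e subset_refl]]
  have "partial_iso \<lparr>univ = A, lt = L, up = U, dn = D\<rparr> S ((\<lambda>a. (a, (e \<circ> g) a)) ` A)"
    by (rule partial_iso_subset) (use g(2) in \<open>auto simp: B_def\<close>)
  then have "embedding (e \<circ> g) \<lparr>univ = A, lt = L, up = U, dn = D\<rparr> S"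
    by (intro embedding_partial_iso) simp
  then show thesis by (rule that)
qed

lemma back_and_forth_list:
  assumes "back_and_forth S" "finite Z" "partial_iso S S Z" "set bs \<subseteq> univ S"
  shows "\<exists>as Y. set as \<subseteq> univ S \<and> finite Y \<and> partial_iso S S Y \<and> Z \<subseteq> Y \<and> list_all2 (\<lambda>a b. (a, b) \<in> Y) as bs"
  using assms(4)
proof (induction bs)
  case Nil
  show ?case using assms(2,3) by (intro exI[of _ "[]"] exI[of _ Z]) simp
next
  case (Cons b bs)
  then obtain as Y where Y: "set as \<subseteq> univ S" "finite Y" "partial_iso S S Y" "Z \<subseteq> Y"
    "list_all2 (\<lambda>a b. (a, b) \<in> Y) as bs" by auto
  obtain a where a: "a \<in> univ S" "partial_iso S S (insert (a, b) Y)"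
    using back_and_forthD'[OF assms(1) Y(2,3)] Cons.prems by auto
  have "list_all2 (\<lambda>x y. (x, y) \<in> insert (a, b) Y) as bs"
    using Y(5) by (rule list_all2_mono) simp
  then show ?case
    using Y a by (intro exI[of _ "a # as"] exI[of _ "insert (a, b) Y"]) auto
qed

text \<open>One tuple \<open>a\<close> serves all pairs \<open>(b, b')\<close> of \<open>Z\<close>
  at once, which is what makes it possible to compare two solution sets through it.\<close>

lemma solutions_back_and_forth:
  assumes bf: "back_and_forth S" and Z: "finite Z" "partial_iso S S Z"
    and \<phi>: "distinct (xs @ [y])" "fvars \<phi> \<subseteq> set (xs @ [y])" "\<forall>c\<in>params \<phi>. (h c, h' c) \<in> Z"
    and a': "a' \<in> tuples S (length xs)"
  obtains a where "a \<in> tuples S (length xs)"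
    "\<forall>b b'. (b, b') \<in> Z \<longrightarrow> (a \<in> solutions S h \<phi> xs [y] [b] \<longleftrightarrow> a' \<in> solutions S h' \<phi> xs [y] [b'])"
proof -
  have "set a' \<subseteq> univ S" and len': "length a' = length xs" using a' by (auto simp: tuples_def)
  from back_and_forth_list[OF bf Z this(1)]
  obtain a Y where Y: "set a \<subseteq> univ S" "finite Y" "partial_iso S S Y" "Z \<subseteq> Y"
    "list_all2 (\<lambda>a b. (a, b) \<in> Y) a a'" by blast
  have len: "length a = length xs" using list_all2_lengthD[OF Y(5)] len' by simp
  then have a: "a \<in> tuples S (length xs)" using Y(1) by (simp add: tuples_def)
  have "a \<in> solutions S h \<phi> xs [y] [b] \<longleftrightarrow> a' \<in> solutions S h' \<phi> xs [y] [b']" if b: "(b, b') \<in> Z" for b b'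
  proof -
    have all: "list_all2 (\<lambda>a b. (a, b) \<in> Y) (a @ [b]) (a' @ [b'])"
      using Y(4,5) b len len' by (auto simp: list_all2_append)
    have "sat S h (the \<circ> map_of (zip (xs @ [y]) (a @ [b]))) \<phi> \<longleftrightarrow>
      sat S h' (the \<circ> map_of (zip (xs @ [y]) (a' @ [b']))) \<phi>"
    proof (rule sat_partial_iso[OF bf Y(2,3)])
      show "\<forall>c\<in>params \<phi>. (h c, h' c) \<in> Y" using \<phi>(3) Y(4) by blast
      show "\<forall>x\<in>fvars \<phi>. ((the \<circ> map_of (zip (xs @ [y]) (a @ [b]))) x,
        (the \<circ> map_of (zip (xs @ [y]) (a' @ [b']))) x) \<in> Y"
      proof
        fix x assume "x \<in> fvars \<phi>"
        then obtain i where i: "i < length (xs @ [y])" "x = (xs @ [y]) ! i"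
          using \<phi>(2) by (metis in_set_conv_nth subsetD)
        have "map_of (zip (xs @ [y]) (a @ [b])) x = Some ((a @ [b]) ! i)"
          "map_of (zip (xs @ [y]) (a' @ [b'])) x = Some ((a' @ [b']) ! i)"
          unfolding i(2) by (rule map_of_zip_nth; use \<phi>(1) i(1) len len' in simp)+
        moreover have "((a @ [b]) ! i, (a' @ [b']) ! i) \<in> Y"
          using list_all2_nthD[OF all] i(1) len by simp
        ultimately show "((the \<circ> map_of (zip (xs @ [y]) (a @ [b]))) x,
          (the \<circ> map_of (zip (xs @ [y]) (a' @ [b']))) x) \<in> Y" by simp
      qed
    qed
    then show ?thesis using a a' by (simp add: solutions_def)
  qed
  then show thesis using that[OF a] by blast
qed

lemma solutions_psubset_transfer:
  assumes bf: "back_and_forth S" and Z: "finite Z" "partial_iso S S Z"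
    and \<phi>: "distinct (xs @ [y])" "fvars \<phi> \<subseteq> set (xs @ [y])" "\<forall>c\<in>params \<phi>. (h c, h' c) \<in> Z"
    and b: "(b, b') \<in> Z" "(c, c') \<in> Z"
    and less: "solutions S h \<phi> xs [y] [b] \<subset> solutions S h \<phi> xs [y] [c]"
  shows "solutions S h' \<phi> xs [y] [b'] \<subset> solutions S h' \<phi> xs [y] [c']"
proof
  have tup: "solutions S k \<phi> xs [y] d \<subseteq> tuples S (length xs)" for k d
    by (auto simp: solutions_def)
  show "solutions S h' \<phi> xs [y] [b'] \<subseteq> solutions S h' \<phi> xs [y] [c']"
  proof
    fix a' assume a': "a' \<in> solutions S h' \<phi> xs [y] [b']"
    obtain a where "a \<in> tuples S (length xs)" and eq: "\<forall>b b'. (b, b') \<in> Z \<longrightarrow>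
      (a \<in> solutions S h \<phi> xs [y] [b] \<longleftrightarrow> a' \<in> solutions S h' \<phi> xs [y] [b'])"
      using solutions_back_and_forth[OF bf Z \<phi> subsetD[OF tup a']] .
    show "a' \<in> solutions S h' \<phi> xs [y] [c']" using eq[rule_format, OF b(1)] eq[rule_format, OF b(2)] a' less by blast
  qed
  obtain a where a: "a \<in> solutions S h \<phi> xs [y] [c]" "a \<notin> solutions S h \<phi> xs [y] [b]"
    using less by blast
  have Z': "finite (Z\<inverse>)" "\<forall>c\<in>params \<phi>. (h' c, h c) \<in> Z\<inverse>" using \<phi>(3) Z(1) by simp_all
  \<comment> \<open>Inclusion pulls tuples back along \<open>Z\<close>; strictness pushes a witness
    forward, which is the same lemma for the converse of \<open>Z\<close>.\<close>
  obtain a' where "a' \<in> tuples S (length xs)" and eq: "\<forall>b b'. (b, b') \<in> Z\<inverse> \<longrightarrow>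
      (a' \<in> solutions S h' \<phi> xs [y] [b] \<longleftrightarrow> a \<in> solutions S h \<phi> xs [y] [b'])"
    using solutions_back_and_forth[OF bf Z'(1) partial_iso_converse[OF Z(2)] \<phi>(1,2) Z'(2) subsetD[OF tup a(1)]] .
  have "a' \<in> solutions S h' \<phi> xs [y] [c']" "a' \<notin> solutions S h' \<phi> xs [y] [b']"
    using a eq[rule_format, of b' b] eq[rule_format, of c' c] b by simp_all
  then show "solutions S h' \<phi> xs [y] [b'] \<noteq> solutions S h' \<phi> xs [y] [c']" by blast
qed

section \<open>Quantifier-free types and Ramsey's theorem\<close>

lemma finite_params: "finite (params \<phi>)"
proof -
  have "finite (tparams t)" for t :: "'c trm" by (cases t) auto
  then show ?thesis by (induction \<phi>) auto
qed

text \<open>Types are sets of index tuples rather than of formulas, so that there are visibly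
  finitely many of each length and they can serve as colours.\<close>

definition qf_type :: "'a lstruct \<Rightarrow> 'a list \<Rightarrow>
    (nat \<times> nat) set \<times> (nat \<times> nat \<times> nat) set \<times> (nat \<times> nat \<times> nat) set \<times> (nat \<times> nat \<times> nat \<times> nat) set" where
  "qf_type S as = (let I = {..<length as} in
     ({(i, j) \<in> I \<times> I. as ! i = as ! j},
      {(i, j, k) \<in> I \<times> I \<times> I. up S (as ! i) (as ! j) (as ! k)},
      {(i, j, k) \<in> I \<times> I \<times> I. dn S (as ! i) (as ! j) (as ! k)},
      {(i, j, k, l) \<in> I \<times> I \<times> I \<times> I. lt S (as ! i) (as ! j) (as ! k) (as ! l)}))"

lemma finite_qf_types: "finite (qf_type S ` {as. length as = m})"
proof (rule finite_subset)
  let ?I = "{..<m}"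
  show "qf_type S ` {as. length as = m} \<subseteq>
    Pow (?I \<times> ?I) \<times> Pow (?I \<times> ?I \<times> ?I) \<times> Pow (?I \<times> ?I \<times> ?I) \<times> Pow (?I \<times> ?I \<times> ?I \<times> ?I)"
    by (auto simp: qf_type_def Let_def)
  show "finite (Pow (?I \<times> ?I) \<times> Pow (?I \<times> ?I \<times> ?I) \<times> Pow (?I \<times> ?I \<times> ?I) \<times> Pow (?I \<times> ?I \<times> ?I \<times> ?I))"
    by (intro finite_cartesian_product finite_Pow_iff[THEN iffD2] finite_lessThan)
qed

lemma partial_iso_qf_type:
  assumes "qf_type S as = qf_type S bs" "length as = length bs" "set as \<subseteq> univ S" "set bs \<subseteq> univ S"
  shows "partial_iso S S ((\<lambda>i. (as ! i, bs ! i)) ` {..<length as})"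
proof -
  have "as ! i \<in> univ S \<and> bs ! i \<in> univ S" if "i < length as" for i
    using assms(2-4) that by (auto dest: nth_mem)
  moreover have "as ! i = as ! j \<longleftrightarrow> bs ! i = bs ! j" if "i < length as" "j < length as" for i j
    using arg_cong[OF assms(1), of "\<lambda>t. (i, j) \<in> fst t"] that assms(2)
    by (simp add: qf_type_def Let_def)
  moreover have "up S (as ! i) (as ! j) (as ! k) \<longleftrightarrow> up S (bs ! i) (bs ! j) (bs ! k)"
    if "i < length as" "j < length as" "k < length as" for i j k
    using arg_cong[OF assms(1), of "\<lambda>t. (i, j, k) \<in> fst (snd t)"] that assms(2)
    by (simp add: qf_type_def Let_def)
  moreover have "dn S (as ! i) (as ! j) (as ! k) \<longleftrightarrow> dn S (bs ! i) (bs ! j) (bs ! k)"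
    if "i < length as" "j < length as" "k < length as" for i j k
    using arg_cong[OF assms(1), of "\<lambda>t. (i, j, k) \<in> fst (snd (snd t))"] that assms(2)
    by (simp add: qf_type_def Let_def)
  moreover have "lt S (as ! i) (as ! j) (as ! k) (as ! l) \<longleftrightarrow> lt S (bs ! i) (bs ! j) (bs ! k) (bs ! l)"
    if "i < length as" "j < length as" "k < length as" "l < length as" for i j k l
    using arg_cong[OF assms(1), of "\<lambda>t. (i, j, k, l) \<in> snd (snd (snd t))"] that assms(2)
    by (simp add: qf_type_def Let_def)
  ultimately show ?thesis
    unfolding partial_iso_image_iff by (intro conjI ballI) simp_all
qed

text \<open>Three members of a homogeneous set are taken. The first partial isomorphism records that
  \<open>(i, j)\<close> and \<open>(j, k)\<close> have the same colour, the second that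
  \<open>(i, j)\<close> and \<open>(i, k)\<close> do.\<close>

lemma indiscernible_triple:
  fixes \<beta> :: "nat \<Rightarrow> 'a"
  assumes "finite C" "C \<subseteq> univ S" "range \<beta> \<subseteq> univ S"
  obtains i j k where "i < j" "j < k"
    "partial_iso S S ({(\<beta> i, \<beta> j), (\<beta> j, \<beta> k)} \<union> Id_on C)"
    "partial_iso S S ({(\<beta> i, \<beta> i), (\<beta> j, \<beta> k)} \<union> Id_on C)"
proof -
  obtain cs where cs: "set cs = C" using finite_list[OF assms(1)] by blast
  define tp where "tp i j = qf_type S ([\<beta> i, \<beta> j] @ cs)" for i j
  let ?T = "qf_type S ` {as. length as = length cs + 2}"
  \<comment> \<open>Colours have to be numbers below a bound, so the types are numbered.\<close>
  obtain f :: "_ \<Rightarrow> nat" and s where f: "f ` ?T = {i. i < s}" "inj_on f ?T"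
    using finite_imp_inj_to_nat_seg[OF finite_qf_types] by blast
  have tp: "tp i j \<in> ?T" for i j by (auto simp: tp_def)
  have fs: "f (tp i j) < s" for i j using f(1) tp[of i j] by blast
  obtain Y t where Y: "infinite Y" "\<forall>x\<in>Y. \<forall>y\<in>Y. x \<noteq> y \<longrightarrow> f (tp (Min {x, y}) (Max {x, y})) = t"
    using Ramsey2[of "UNIV :: nat set" "\<lambda>X. f (tp (Min X) (Max X))" s] fs by auto
  have col: "f (tp x y) = t" if "x \<in> Y" "y \<in> Y" "x < y" for x y
    using Y(2)[rule_format, OF that(1,2)] that(3) by (simp add: min_def max_def)
  obtain i where i: "i \<in> Y" using infinite_imp_nonempty[OF Y(1)] by blast
  note unbounded = Y(1)[unfolded infinite_nat_iff_unbounded, rule_format]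
  obtain j where j: "j \<in> Y" "i < j" using unbounded by blast
  obtain k where k: "k \<in> Y" "j < k" using unbounded by blast
  have eq: "tp i j = tp j k" "tp i j = tp i k"
    by (rule inj_onD[OF f(2) _ tp tp]; simp add: col i j k less_trans[OF j(2) k(2)])+
  have iso: "partial_iso S S ({(\<beta> p, \<beta> r), (\<beta> q, \<beta> u)} \<union> Id_on C)" if "tp p q = tp r u" for p q r u
  proof (rule partial_iso_subset[OF partial_iso_qf_type[OF that[unfolded tp_def]]])
    show "set ([\<beta> p, \<beta> q] @ cs) \<subseteq> univ S" "set ([\<beta> r, \<beta> u] @ cs) \<subseteq> univ S"
      using assms(2,3) cs by auto
    let ?n = "length ([\<beta> p, \<beta> q] @ cs)" and ?g = "\<lambda>i. (([\<beta> p, \<beta> q] @ cs) ! i, ([\<beta> r, \<beta> u] @ cs) ! i)"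
    have "?g 0 \<in> ?g ` {..<?n}" "?g 1 \<in> ?g ` {..<?n}" by (intro imageI; simp)+
    moreover have "(c, c) \<in> ?g ` {..<?n}" if c: "c \<in> C" for c
    proof -
      obtain m where m: "m < length cs" "c = cs ! m" using c cs by (metis in_set_conv_nth)
      have "?g (m + 2) \<in> ?g ` {..<?n}" using m by (intro imageI) simp
      then show ?thesis using m by simp
    qed
    ultimately show "{(\<beta> p, \<beta> r), (\<beta> q, \<beta> u)} \<union> Id_on C \<subseteq> ?g ` {..<?n}" by auto
  qed simp
  show thesis by (rule that[OF j(2) k(2) iso[OF eq(1)] iso[OF eq(2)]])
qed

section \<open>The contradiction from a strict chain\<close>

lemma no_cyclic_chain:
  fixes V :: "int \<Rightarrow> 'a set"
  assumes "n > 0" "\<And>i. i \<in> {0..<n} \<Longrightarrow> V i \<subset> V ((i + 1) mod n)"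
  shows False
proof -
  have "V (int k mod n) \<subset> V (int (Suc k) mod n)" for k
    using assms(2)[of "int k mod n"] assms(1) by (simp add: mod_add_left_eq mod_add_right_eq add.commute[of 1])
  then have "V (int 0 mod n) \<subset> V (int (nat n) mod n)"
    by (rule lift_Suc_mono_less) (use assms(1) in simp)
  then show False using assms(1) by simp
qed

lemma no_strict_chain:
  fixes \<beta> :: "nat \<Rightarrow> 'a"
  assumes age: "age S = finite_labeled_switchboards" and bf: "back_and_forth S"
    and \<phi>: "distinct (xs @ [y])" "fvars \<phi> \<subseteq> set (xs @ [y])" "h ` params \<phi> \<subseteq> univ S"
    and \<beta>: "range \<beta> \<subseteq> univ S"
    and chain: "\<And>i. solutions S h \<phi> xs [y] [\<beta> i] \<subset> solutions S h \<phi> xs [y] [\<beta> (Suc i)]"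
  shows False
proof -
  define C where "C = h ` params \<phi>"
  have CS: "finite C" "C \<subseteq> univ S" using \<phi>(3) finite_params by (auto simp: C_def)
  obtain i j k where ijk: "i < j" "j < k"
    and p1: "partial_iso S S ({(\<beta> i, \<beta> j), (\<beta> j, \<beta> k)} \<union> Id_on C)"
    and p2: "partial_iso S S ({(\<beta> i, \<beta> i), (\<beta> j, \<beta> k)} \<union> Id_on C)"
    using indiscernible_triple[OF CS \<beta>] .
  have mono: "solutions S h \<phi> xs [y] [\<beta> a] \<subset> solutions S h \<phi> xs [y] [\<beta> b]" if "a < b" for a b
    by (rule lift_Suc_mono_less[of "\<lambda>i. solutions S h \<phi> xs [y] [\<beta> i]", OF chain that])
  have ne: "\<beta> i \<noteq> \<beta> j" "\<beta> j \<noteq> \<beta> k"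
    using mono[OF ijk(1)] mono[OF ijk(2)] by auto
  define b0 b1 b2 where "b0 = \<beta> i" and "b1 = \<beta> j" and "b2 = \<beta> k"
  note b_defs = b0_def[symmetric] b1_def[symmetric] b2_def[symmetric]
  let ?Y = "{(b0, b1), (b1, b2)} \<union> Id_on C" and ?Y' = "{(b0, b0), (b1, b2)} \<union> Id_on C"
  have Y: "(b0, b1) \<in> ?Y" "(b1, b2) \<in> ?Y" "\<And>c. c \<in> C \<Longrightarrow> (c, c) \<in> ?Y"
    and Y': "(b0, b0) \<in> ?Y'" "(b1, b2) \<in> ?Y'" "\<And>c. c \<in> C \<Longrightarrow> (c, c) \<in> ?Y'" by auto
  note p1 = p1[unfolded b_defs] and p2 = p2[unfolded b_defs] and ne = ne[unfolded b_defs]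
  have univ: "b0 \<in> univ S" "b1 \<in> univ S" "b2 \<in> univ S"
    using \<beta> by (auto simp: b0_def b1_def b2_def)
  \<comment> \<open>The first partial isomorphism fixes \<open>C\<close> but moves \<open>b0\<close>
    to \<open>b1\<close> and \<open>b1\<close> to \<open>b2\<close>, which differ because their
    solution sets do.\<close>
  have notC: "b0 \<notin> C" "b1 \<notin> C"
    using partial_isoD(3)[OF p1 Y(1) Y(3)[of b0]] partial_isoD(3)[OF p1 Y(2) Y(3)[of b1]] ne by auto
  let ?A = "{b0, b1, b2} \<union> C"
  let ?L = "on4 ?A (lt S)" and ?U = "on3 ?A (up S)" and ?D = "on3 ?A (dn S)"
  have sb: "switchboard ?A ?L ?U ?D"
    by (rule switchboard_finite_subset[OF age]) (use univ CS in auto)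
  note I4 = partial_isoD(6)[OF p1] and I4' = partial_isoD(6)[OF p2]
    and I3 = partial_isoD(4,5)[OF p1]
  have "indiscernible ?A ?L ?U ?D C b0 b1 b2"
  proof (rule indiscernible.intro[OF sb], rule indiscernible_axioms.intro)
    fix c e f assume "c \<in> C" "e \<in> C" "f \<in> C"
    note m = Y(3)[OF this(1)] Y(3)[OF this(2)] Y(3)[OF this(3)] and ce = this
    show "?L b1 c e f \<longleftrightarrow> ?L b0 c e f" "?L e f b1 c \<longleftrightarrow> ?L e f b0 c"
      using I4[OF Y(1) m] I4[OF m(2,3) Y(1) m(1)] ce by (auto simp: on4_def)
  next
    fix c e assume "c \<in> C" "e \<in> C"
    note m = Y(3)[OF this(1)] Y(3)[OF this(2)] and m' = Y'(3)[OF this(1)] Y'(3)[OF this(2)]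
      and ce = this
    show "?L b1 c b2 e \<longleftrightarrow> ?L b0 c b1 e" "?L b2 c b1 e \<longleftrightarrow> ?L b1 c b0 e"
      using I4[OF Y(1) m(1) Y(2) m(2)] I4[OF Y(2) m(1) Y(1) m(2)] ce by (auto simp: on4_def)
    show "?L b0 c b2 e \<longleftrightarrow> ?L b0 c b1 e" "?L b2 c b0 e \<longleftrightarrow> ?L b1 c b0 e"
      using I4'[OF Y'(1) m'(1) Y'(2) m'(2)] I4'[OF Y'(2) m'(1) Y'(1) m'(2)] ce by (auto simp: on4_def)
    show "?U c b1 e \<longleftrightarrow> ?U c b0 e" "?U b1 c e \<longleftrightarrow> ?U b0 c e"
      "?D c b1 e \<longleftrightarrow> ?D c b0 e" "?D b1 c e \<longleftrightarrow> ?D b0 c e"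
      using I3[OF m(1) Y(1) m(2)] I3[OF Y(1) m] ce by (auto simp: on3_def)
  next
    fix c assume "c \<in> C"
    note m = Y(3)[OF this] and c = this
    show "?U b1 b2 c \<longleftrightarrow> ?U b0 b1 c" "?D b1 b2 c \<longleftrightarrow> ?D b0 b1 c"
      using I3[OF Y(1,2) m] c by (auto simp: on3_def)
  qed (use CS notC ne in auto)
  then interpret indiscernible ?A ?L ?U ?D C b0 b1 b2 .
  let ?B = "insert b0 (insert b1 C)"
  obtain U' D' where X: "switchboard X LX U' D'"
    and UD: "\<forall>i\<in>{0..<n}. \<forall>a\<in>?B. \<forall>c\<in>?B. \<forall>e\<in>?B.
      (U' (chart i a) (chart i c) (chart i e) \<longleftrightarrow> ?U a c e) \<and>
      (D' (chart i a) (chart i c) (chart i e) \<longleftrightarrow> ?D a c e)"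
    using cyclic_amalgam .
  obtain g where g: "embedding g \<lparr>univ = X, lt = LX, up = U', dn = D'\<rparr> S"
    using switchboard_embeds[OF age finite_X X] .
  have g_univ: "g x \<in> univ S" if "x \<in> X" for x
    using g that by (auto simp: embedding_def)
  have g_eq: "g x = g z \<longleftrightarrow> x = z" if "x \<in> X" "z \<in> X" for x z
    using g that by (auto simp: embedding_def inj_on_def)
  have g_lt: "LX x z u v \<longleftrightarrow> lt S (g x) (g z) (g u) (g v)" if "x \<in> X" "z \<in> X" "u \<in> X" "v \<in> X" for x z u v
    using g that by (simp add: embedding_def)
  have g_up: "U' x z u \<longleftrightarrow> up S (g x) (g z) (g u)" if "x \<in> X" "z \<in> X" "u \<in> X" for x z u
    using g that by (simp add: embedding_def)
  have g_dn: "D' x z u \<longleftrightarrow> dn S (g x) (g z) (g u)" if "x \<in> X" "z \<in> X" "u \<in> X" for x z u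
    using g that by (simp add: embedding_def)
  \<comment> \<open>The moved parameters do not depend on the chart, so all inclusions around the
    cycle concern one and the same family of sets.\<close>
  define h' where "h' c = g (Inl (h c))" for c
  show False
  proof (rule no_cyclic_chain)
    show "n > 0" using n_ge by simp
    fix l assume l: "l \<in> {0..<n}"
    let ?Z = "(\<lambda>a. (a, g (chart l a))) ` ?B"
    have B: "?B \<subseteq> ?A" "?B \<subseteq> univ S" using univ CS by auto
    note cX = chart_X[OF l]
    have Z: "partial_iso S S ?Z"
      unfolding partial_iso_image_iff
    proof (intro conjI ballI)
      fix a assume a: "a \<in> ?B"
      show "a \<in> univ S" "g (chart l a) \<in> univ S" using a B g_univ cX by auto
      fix c assume c: "c \<in> ?B"
      show "a = c \<longleftrightarrow> g (chart l a) = g (chart l c)"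
        using g_eq[OF cX cX] inj_onD[OF chart_inj[of l]] a c by metis
      fix e assume e: "e \<in> ?B"
      have A: "a \<in> ?A" "c \<in> ?A" "e \<in> ?A" using a c e B(1) by auto
      show "up S a c e \<longleftrightarrow> up S (g (chart l a)) (g (chart l c)) (g (chart l e))"
        using g_up[OF cX[OF a] cX[OF c] cX[OF e]] UD[rule_format, OF l a c e] A by (simp add: on3_def)
      show "dn S a c e \<longleftrightarrow> dn S (g (chart l a)) (g (chart l c)) (g (chart l e))"
        using g_dn[OF cX[OF a] cX[OF c] cX[OF e]] UD[rule_format, OF l a c e] A by (simp add: on3_def)
      fix f assume f: "f \<in> ?B"
      then have "f \<in> ?A" using B(1) by auto
      then show "lt S a c e f \<longleftrightarrow> lt S (g (chart l a)) (g (chart l c)) (g (chart l e)) (g (chart l f))"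
        using g_lt[OF cX[OF a] cX[OF c] cX[OF e] cX[OF f]] chart_L[OF l a c e f] A by (simp add: on4_def)
    qed
    have hh: "\<forall>c\<in>params \<phi>. (h c, h' c) \<in> ?Z"
    proof
      fix c assume "c \<in> params \<phi>"
      then have c: "h c \<in> C" by (simp add: C_def)
      then have "h' c = g (chart l (h c))" by (simp add: h'_def)
      then show "(h c, h' c) \<in> ?Z" using c by blast
    qed
    have "(b0, g (chart l b0)) \<in> ?Z" "(b1, g (chart l b1)) \<in> ?Z" by blast+
    then have bZ: "(b0, g (Inr l)) \<in> ?Z" "(b1, g (Inr ((l + 1) mod n))) \<in> ?Z"
      by (simp_all only: chart_simps)
    have fin: "finite ?Z" using CS(1) by simp
    have less: "solutions S h \<phi> xs [y] [b0] \<subset> solutions S h \<phi> xs [y] [b1]"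
      using mono[OF ijk(1)] by (simp add: b0_def b1_def)
    show "solutions S h' \<phi> xs [y] [g (Inr l)] \<subset> solutions S h' \<phi> xs [y] [g (Inr ((l + 1) mod n))]"
      by (rule solutions_psubset_transfer[OF bf fin Z \<phi>(1,2) hh bZ less])
  qed
qed

theorem theorem4p28:
  fixes F :: "'f lstruct" and M :: "'m lstruct" and \<phi> :: "'m fm" and xs ys :: "nat list"
  assumes "fraisse_limit finite_labeled_switchboards F"
    and "models M id (complete_theory F)"
    and "partitioned_formula (univ M) \<phi> xs ys"
    and "length ys = 1"
  shows "NSOP TYPE('n) (univ M) (elementary_diagram M) \<phi> xs ys"
proof
  assume "SOP TYPE('n) (univ M) (elementary_diagram M) \<phi> xs ys"
  then obtain N :: "'n lstruct" and h b where h: "h ` univ M \<subseteq> univ N"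
    and N: "models N h (elementary_diagram M)"
    and b_chain: "\<forall>i :: nat. b i \<in> tuples N (length ys) \<and>
      solutions N h \<phi> xs ys (b i) \<subset> solutions N h \<phi> xs ys (b (Suc i))"
    unfolding SOP_def by (elim exE conjE)
  note b = b_chain[rule_format, THEN conjunct1] and chain = b_chain[rule_format, THEN conjunct2]
  have "complete_theory F \<subseteq> elementary_diagram M"
    using assms(2) by (auto simp: complete_theory_def elementary_diagram_def sentences_def models_def)
  then have "models N h (complete_theory F)" using N unfolding models_def by blast
  then have eq: "elementarily_equivalent TYPE('m) F N"
    by (rule elementarily_equivalent_complete_theory)
  have age: "age N = finite_labeled_switchboards"
    using age_elementarily_equivalent_subset[OF eq]
      age_elementarily_equivalent_subset[OF elementarily_equivalent_sym[OF eq]] assms(1)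
    by (auto simp: fraisse_limit_def)
  have bf: "back_and_forth N"
    using back_and_forth_ultrahomogeneous[OF eq] assms(1) by (simp add: fraisse_limit_def)
  obtain y where y: "ys = [y]" using assms(4) by (auto simp: length_Suc_conv)
  define \<beta> where "\<beta> i = hd (b i)" for i
  have \<beta>: "b i = [\<beta> i]" "\<beta> i \<in> univ N" for i
    using b[of i] by (auto simp: \<beta>_def tuples_def y length_Suc_conv)
  show False
  proof (rule no_strict_chain[OF age bf, of xs y \<phi> h \<beta>])
    show "distinct (xs @ [y])" "fvars \<phi> \<subseteq> set (xs @ [y])" "h ` params \<phi> \<subseteq> univ N" "range \<beta> \<subseteq> univ N"
      using assms(3) h \<beta>(2) unfolding partitioned_formula_def y by auto
    show "solutions N h \<phi> xs [y] [\<beta> i] \<subset> solutions N h \<phi> xs [y] [\<beta> (Suc i)]" for i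
      using chain[of i] unfolding \<beta>(1) y .
  qed
qed

end
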